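(* Let $p>3$ be prime and $0\le m\le p-1$. Then (i) $\mathcal{K}^{(C)}_{p,0}(\zeta_p,z)$ is a weakly holomorphic modular form of weight $1$ on $\Gamma_1(p)$; (ii) if $1\le m\le p-1$, then $\mathcal{K}^{(C)}_{p,m}(\zeta_p,z)$ is a weakly holomorphic modular form of weight $1$ on $\Gamma(p)$, and in particular $$\big(\mathcal{K}^{(C)}_{p,m}(\zeta_p,z)\big)\big|[A]_1=\exp\!\Big(\frac{2\pi i bm}{p}\Big)\,\mathcal{K}^{(C)}_{p,m}(\zeta_p,z)\quad\text{for all } A=\begin{pmatrix} a&b\\ c&d\end{pmatrix}\in\Gamma_1(p).$$
   Context: $z$ in the upper half-plane, $q=e^{2\pi i z}$, $q^r=e^{2\pi i r z}$, $\zeta_p=e^{2\pi i/p}$, $(a;q)_\infty=\prod_{k\ge0}(1-aq^k)$; $(F|[A]_k)(z)=(cz+d)^{-k}F\big(\tfrac{az+b}{cz+d}\big)$. Crank generating function: $C(x,q)=\frac{(q;q)_\infty}{(xq;q)_\infty(x^{-1}q;q)_\infty}$; write $C(\zeta_p,q)=\sum_{n\ge0}c(n)q^n$ with $c(n)=0$ for $n<0$ (equivalently $c(n)=\sum_{k=0}^{p-1}M(k,p,n)\zeta_p^{k}$ where $M(k,p,n)$ counts partitions of $n$ with crank $\equiv k \pmod p$, with the generating-function convention at $n=1$). Let $s_p=\frac{p^2-1}{24}$ and $\mathcal{K}^{(C)}_{p,m}(\zeta_p,z)=q^{m/p}\prod_{n\ge1}(1-q^{pn})\sum_{n\in\mathbb{Z}}c(pn+m-s_p)\,q^n$.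 *)

theory Defs
  imports "HOL-Complex_Analysis.Complex_Analysis" "HOL-Computational_Algebra.Formal_Power_Series"
begin

definition upper_half_plane :: "complex set" where
  "upper_half_plane = {z. Im z > 0}"

text \<open>An integer 2x2 matrix (a b; c d) is represented as the tuple (a,b,c,d).\<close>
type_synonym mat2 = "int \<times> int \<times> int \<times> int"

definition SL2Z :: "mat2 set" where
  "SL2Z = {(a,b,c,d). a*d - b*c = 1}"

definition Gamma1 :: "nat \<Rightarrow> mat2 set" where
  "Gamma1 N = {(a,b,c,d). (a,b,c,d) \<in> SL2Z \<and> c mod int N = 0 mod int N \<and>
                  a mod int N = 1 mod int N \<and> d mod int N = 1 mod int N}"

definition GammaN :: "nat \<Rightarrow> mat2 set" where
  "GammaN N = {(a,b,c,d). (a,b,c,d) \<in> SL2Z \<and> b mod int N = 0 mod int N \<and> c mod int N = 0 mod int N \<and>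
                  a mod int N = 1 mod int N \<and> d mod int N = 1 mod int N}"

definition slash :: "int \<Rightarrow> mat2 \<Rightarrow> (complex \<Rightarrow> complex) \<Rightarrow> complex \<Rightarrow> complex" where
  "slash k A F z = (case A of (a,b,c,d) \<Rightarrow>
      (of_int c * z + of_int d) powi (-k) * F ((of_int a * z + of_int b) / (of_int c * z + of_int d)))"

definition meromorphic_at_infinity :: "(complex \<Rightarrow> complex) \<Rightarrow> bool" where
  "meromorphic_at_infinity g \<longleftrightarrow>
     (\<exists>h::nat. h > 0 \<and> (\<exists>N::int. \<exists>a::int \<Rightarrow> complex. \<forall>z\<in>upper_half_plane.
        ((\<lambda>n. a n * exp (2 * pi * \<i> * of_int n * z / of_nat h)) has_sum g z) {N..}))"

definition weakly_holomorphic_modular_form ::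
    "int \<Rightarrow> mat2 set \<Rightarrow> (complex \<Rightarrow> complex) \<Rightarrow> bool" where
  "weakly_holomorphic_modular_form k G f \<longleftrightarrow>
     f holomorphic_on upper_half_plane \<and>
     (\<forall>A\<in>G. \<forall>z\<in>upper_half_plane. slash k A f z = f z) \<and>
     (\<forall>A\<in>SL2Z. meromorphic_at_infinity (slash k A f))"

definition zeta :: "nat \<Rightarrow> complex" where
  "zeta p = exp (2 * pi * \<i> / of_nat p)"

text \<open>C(x,q) = prod_{k>=1} (1-q^k)/((1-xq^k)(1-x^{-1}q^k)); the coefficient of q^n only depends
  on the factors with k <= n, so c(n) is the n-th coefficient of the finite product.\<close>
definition crank_factor :: "complex \<Rightarrow> nat \<Rightarrow> complex fps" where
  "crank_factor x k = (1 - fps_X ^ k) /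
     ((1 - fps_const x * fps_X ^ k) * (1 - fps_const (inverse x) * fps_X ^ k))"

definition crank_coeff_nat :: "complex \<Rightarrow> nat \<Rightarrow> complex" where
  "crank_coeff_nat x n = fps_nth (\<Prod>k\<in>{1..n}. crank_factor x k) n"

definition crank_c :: "nat \<Rightarrow> int \<Rightarrow> complex" where
  "crank_c p n = (if n < 0 then 0 else crank_coeff_nat (zeta p) (nat n))"

definition s_p :: "nat \<Rightarrow> int" where
  "s_p p = (int p ^ 2 - 1) div 24"

definition K_crank :: "nat \<Rightarrow> nat \<Rightarrow> complex \<Rightarrow> complex" where
  "K_crank p m z =
     exp (2 * pi * \<i> * (of_nat m / of_nat p) * z) *
     (\<Prod>n. 1 - exp (2 * pi * \<i> * z) ^ (p * Suc n)) *
     (\<Sum>\<^sub>\<infinity>n\<in>(UNIV::int set). crank_c p (int p * n + int m - s_p p) * exp (2 * pi * \<i> * of_int n * z))"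

end

theory Submission
  imports Defs
begin

text \<open>
  Write \<open>q = ecis t = exp (2 \<pi> \<i> t)\<close>. With the weight \<open>-1\<close>, index \<open>1/2\<close> function
  \<open>theta u t = \<theta>\<^sub>1(u; t) / \<eta>(t)\<^sup>3\<close> (suitably normalised) one has
  \<open>\<eta>(p\<^sup>2 t) q\<^bsup>-1/24\<^esup> C(\<zeta>\<^sub>p, q) = const \<cdot> (\<eta>(p\<^sup>2 t) / \<eta>(t)) / theta (1/p) t\<close>, and \<open>K\<^sub>p\<^sub>,\<^sub>m(z)\<close> is the
  average of \<open>\<zeta>\<^sub>p\<^bsup>-mk\<^esup>\<close> times this function at \<open>(z + k) / p\<close>, over \<open>k\<close> modulo \<open>p\<close>. So it
  suffices that the function has weight 1 on \<open>\<Gamma>\<^sub>0(p\<^sup>2) \<inter> \<Gamma>\<^sub>1(p)\<close>.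

  The transformation of \<open>theta\<close> under all of \<open>SL\<^sub>2(\<int>)\<close> is Liouville's theorem: both sides are theta
  functions in \<open>u\<close> with the same quasi-periods and simple zeros. No multiplier system of \<open>\<eta>\<close> is
  needed: by the quintuple product identity \<open>\<eta>(t) theta (2u) t / theta u t\<close> is a unary theta
  series, and sieving out its exponents divisible by \<open>p\<close> expresses \<open>\<eta>(p\<^sup>2 t) / \<eta>(t)\<close> as a
  combination of the weight 0 quotients \<open>theta (4j/p) t / theta (2j/p) t\<close>.
\<close>

section \<open>q-Pochhammer products\<close>

text \<open>The level p^2 is forced by the averaging: passing to the points (z + k) / p conjugates a
  matrix congruent to the identity modulo p into one whose lower left entry is divisible by p^2. An
  element of \<open>Gamma1 p\<close> moreover permutes the p summands by k -> k + b, and relabelling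
  the weights exp (- 2 pi i m k / p) produces the multiplier exp (2 pi i b m / p). The weight comes
  from \<open>theta\<close> alone, whose weight -1 stands in the denominator. The sieve returns the
  same kind of series because the pentagonal exponents are ((6 n + 1)^2 - 1) / 24. As p is 1 or -1
  modulo 6, write p = |r| with r = 6 e + 1; the n with p dividing 6 n + 1 are those with 6 n + 1 = r
  (6 k + 1) for some integer k, and the exponent becomes \<open>s_p p\<close> plus p^2 times the
  pentagonal exponent of k. At the cusps only growth is controlled: a bound exp (M / Im t) is sent
  by a Moebius map to exp (M' Im z) on vertical strips away from the real line, which allows a pole
  of finite order and nothing worse.\<close>

definition qpoch :: "complex \<Rightarrow> complex \<Rightarrow> complex" where
  "qpoch x q = (\<Prod>n. 1 - x * q ^ n)"

lemma convergent_prod_qpoch: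
  fixes x q :: complex
  assumes "norm q < 1"
  shows "convergent_prod (\<lambda>n. 1 - x * q ^ n)"
proof -
  have "summable (\<lambda>n. norm (1 - x * q ^ n - 1))"
    using assms by (simp add: norm_mult norm_power summable_mult summable_geometric)
  thus ?thesis
    by (intro abs_convergent_prod_imp_convergent_prod summable_imp_abs_convergent_prod)
qed

lemma qpoch_has_prod: "norm q < 1 \<Longrightarrow> (\<lambda>n. 1 - x * q ^ n) has_prod qpoch x q"
  unfolding qpoch_def by (intro convergent_prod_has_prod convergent_prod_qpoch)

lemma qpoch_LIMSEQ:
  "norm q < 1 \<Longrightarrow> (\<lambda>N. \<Prod>n<N. 1 - x * q ^ n) \<longlonglongrightarrow> qpoch x q"
  by (rule has_prod_imp_tendsto'[OF qpoch_has_prod])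

lemma qpoch_eq_0_iff: "norm q < 1 \<Longrightarrow> qpoch x q = 0 \<longleftrightarrow> (\<exists>n. x * q ^ n = 1)"
  using has_prod_eq_0_iff[OF qpoch_has_prod[of q x]] by (auto simp: image_iff)

lemma qpoch_nonzero:
  assumes "norm q < 1" "norm x < 1"
  shows "qpoch x q \<noteq> 0"
proof -
  have "norm (x * q ^ n) < 1" for n
  proof -
    have "norm x * norm q ^ n \<le> norm x * 1"
      by (intro mult_left_mono power_le_one) (use assms in auto)
    thus ?thesis using assms by (simp add: norm_mult norm_power)
  qed
  thus ?thesis using assms by (auto simp: qpoch_eq_0_iff) (metis less_irrefl norm_one)
qed

lemma qpoch_rec:
  assumes "norm q < 1"
  shows "qpoch x q = (1 - x) * qpoch (x * q) q"
proof (rule LIMSEQ_unique)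
  show "(\<lambda>N. \<Prod>n<Suc N. 1 - x * q ^ n) \<longlonglongrightarrow> qpoch x q"
    using qpoch_LIMSEQ[OF assms] by (rule LIMSEQ_Suc)
  have "(\<lambda>N. (1 - x) * (\<Prod>n<N. 1 - x * q * q ^ n)) \<longlonglongrightarrow> (1 - x) * qpoch (x * q) q"
    by (intro tendsto_intros qpoch_LIMSEQ assms)
  thus "(\<lambda>N. \<Prod>n<Suc N. 1 - x * q ^ n) \<longlonglongrightarrow> (1 - x) * qpoch (x * q) q"
    by (subst prod.lessThan_Suc_shift) (simp add: mult_ac)
qed

lemma uniform_limit_qpoch:
  assumes "compact A" "continuous_on A X" "continuous_on A Q" "\<And>z. z \<in> A \<Longrightarrow> norm (Q z) < 1"
  shows "uniform_limit A (\<lambda>N z. \<Prod>n<N. 1 - X z * Q z ^ n) (\<lambda>z. qpoch (X z) (Q z)) sequentially"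
proof (cases "A = {}")
  case False
  have "bounded (X ` A)"
    using assms compact_continuous_image compact_imp_bounded by blast
  then obtain B where B: "\<And>z. z \<in> A \<Longrightarrow> norm (X z) \<le> B"
    by (force simp: bounded_iff)
  \<comment> \<open>The maximum of \<open>norm (Q z)\<close> is attained, so it is itself below 1
    and can serve as the ratio of one geometric majorant for the whole compact set.\<close>
  obtain z0 where z0: "z0 \<in> A" "\<And>z. z \<in> A \<Longrightarrow> norm (Q z) \<le> norm (Q z0)"
    using continuous_attains_sup[OF assms(1) False continuous_on_norm[OF assms(3)]] by auto
  define r where "r = norm (Q z0)"
  have r: "r < 1" "r \<ge> 0" using z0 assms by (auto simp: r_def)
  have "uniformly_convergent_on A (\<lambda>N z. \<Sum>n<N. norm (- X z * Q z ^ n))"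
  proof (rule Weierstrass_m_test')
    show "norm (norm (- X z * Q z ^ n)) \<le> B * r ^ n" if "z \<in> A" for n z
      using B[OF that] z0(2)[OF that] order_trans[OF norm_ge_zero B[OF that]]
      by (auto simp: norm_mult norm_power r_def intro!: mult_mono power_mono)
    show "summable (\<lambda>n. B * r ^ n)"
      using r by (intro summable_mult summable_geometric) auto
  qed
  hence "uniformly_convergent_on A (\<lambda>N z. \<Prod>n<N. 1 + (- X z * Q z ^ n))"
    by (intro uniformly_convergent_on_prod assms continuous_intros)
  hence ul: "uniform_limit A (\<lambda>N z. \<Prod>n<N. 1 - X z * Q z ^ n)
          (\<lambda>z. lim (\<lambda>N. \<Prod>n<N. 1 - X z * Q z ^ n)) sequentially"
    by (simp add: uniformly_convergent_uniform_limit_iff)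
  have "lim (\<lambda>N. \<Prod>n<N. 1 - X z * Q z ^ n) = qpoch (X z) (Q z)" if "z \<in> A" for z
    using qpoch_LIMSEQ[OF assms(4)[OF that]] by (rule limI)
  with ul show ?thesis
    by (subst uniform_limit_cong'[where f = "\<lambda>N z. \<Prod>n<N. 1 - X z * Q z ^ n" and i = "\<lambda>z. lim (\<lambda>N. \<Prod>n<N. 1 - X z * Q z ^ n)"]) auto
qed auto

lemma holomorphic_qpoch:
  assumes "open A" "X holomorphic_on A" "Q holomorphic_on A" "\<And>z. z \<in> A \<Longrightarrow> norm (Q z) < 1"
  shows "(\<lambda>z. qpoch (X z) (Q z)) holomorphic_on A"
proof (rule holomorphic_uniform_sequence[OF assms(1)])
  show "(\<lambda>z. \<Prod>n<N. 1 - X z * Q z ^ n) holomorphic_on A" for N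
    using assms by (intro holomorphic_intros)
  fix z assume "z \<in> A"
  then obtain d where d: "d > 0" "cball z d \<subseteq> A"
    using assms(1) open_contains_cball by blast
  have "uniform_limit (cball z d) (\<lambda>N z. \<Prod>n<N. 1 - X z * Q z ^ n)
          (\<lambda>z. qpoch (X z) (Q z)) sequentially"
    using d assms
    by (intro uniform_limit_qpoch)
       (auto intro: continuous_on_subset[OF holomorphic_on_imp_continuous_on])
  with d show "\<exists>d>0. cball z d \<subseteq> A \<and> uniform_limit (cball z d) (\<lambda>N z. \<Prod>n<N. 1 - X z * Q z ^ n)
          (\<lambda>z. qpoch (X z) (Q z)) sequentially" by blast
qed

lemma holomorphic_qpoch' [holomorphic_intros]:
  assumes "open A" "X holomorphic_on A" "norm q < 1"
  shows "(\<lambda>z. qpoch (X z) q) holomorphic_on A"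
  using assms by (intro holomorphic_qpoch) auto

section \<open>Upper and lower bounds for q-products\<close>

lemma prod_le_exp_inverse:
  fixes r :: real
  assumes "0 \<le> r" "r < 1"
  shows "(\<Prod>n<N. 1 + r * r ^ n) \<le> exp (1 / (1 - r))"
proof -
  have "(\<Prod>n<N. 1 + r * r ^ n) \<le> exp (\<Sum>n<N. r * r ^ n)"
    using assms by (intro prod_le_exp_sum) auto
  also have "(\<Sum>n<N. r * r ^ n) \<le> (\<Sum>n. r ^ n)"
  proof -
    have "(\<Sum>n<N. r * r ^ n) \<le> (\<Sum>n<N. r ^ n)"
      using assms by (intro sum_mono) (auto simp: mult_left_le_one_le)
    also have "\<dots> \<le> (\<Sum>n. r ^ n)"
      using assms by (intro sum_le_suminf) (auto intro: summable_geometric)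
    finally show ?thesis .
  qed
  also have "(\<Sum>n. r ^ n) = 1 / (1 - r)" using assms by (subst suminf_geometric) auto
  finally show ?thesis by simp
qed

text \<open>For norm q = exp (-t) the exponent 1 / (1 - norm q) is at most 1 + 1 / t
  (\<open>inverse_one_minus_exp_le\<close>), the linear order in 1 / t that the cusps
  require.\<close>

lemma norm_qpoch_le:
  assumes "norm q < 1" "norm x \<le> norm q"
  shows "norm (qpoch x q) \<le> exp (1 / (1 - norm q))"
proof (rule tendsto_upperbound)
  show "(\<lambda>N. norm (\<Prod>n<N. 1 - x * q ^ n)) \<longlonglongrightarrow> norm (qpoch x q)"
    by (intro tendsto_norm qpoch_LIMSEQ assms)
  have "norm (\<Prod>n<N. 1 - x * q ^ n) \<le> exp (1 / (1 - norm q))" for N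
  proof -
    have "norm (\<Prod>n<N. 1 - x * q ^ n) \<le> (\<Prod>n<N. 1 + norm q * norm q ^ n)"
      unfolding prod_norm[symmetric]
    proof (intro prod_mono conjI)
      fix n show "norm (1 - x * q ^ n) \<le> 1 + norm q * norm q ^ n"
        by (rule order_trans[OF norm_triangle_ineq4])
           (use assms in \<open>auto simp: norm_mult norm_power intro!: mult_right_mono\<close>)
    qed auto
    also have "\<dots> \<le> exp (1 / (1 - norm q))"
      using assms by (intro prod_le_exp_inverse) auto
    finally show ?thesis .
  qed
  thus "eventually (\<lambda>N. norm (\<Prod>n<N. 1 - x * q ^ n) \<le> exp (1 / (1 - norm q))) sequentially"
    by simp
qed auto

lemma summable_inverse_squares: "summable (\<lambda>j. 1 / real (Suc j) ^ 2)"
  using inverse_power_summable[of 2, where 'a = real] by (subst summable_Suc_iff) (auto simp: field_simps)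

text \<open>Expanding the logarithm and summing over \<open>n\<close> first keeps the exponent linear in \<open>1/t\<close>;
  the naive bound is only quadratic, which would not suffice at the cusps.\<close>
lemma prod_ge_exp_neg_inverse:
  fixes t :: real
  assumes "t > 0"
  shows "(\<Prod>n<N. 1 - exp (-t) * exp (-t) ^ n) \<ge> exp (- (\<Sum>j. 1 / real (Suc j) ^ 2) / t)"
proof -
  define L where "L = (\<Sum>j. 1 / real (Suc j) ^ 2)"
  define r where "r = exp (-t)"
  have r: "0 < r" "r < 1" using assms by (auto simp: r_def)
  have pos: "0 < r * r ^ n" "r * r ^ n < 1" for n
  proof -
    show "0 < r * r ^ n" using r by simp
    have "r * r ^ n \<le> r * 1" using r by (intro mult_left_mono power_le_one) auto
    thus "r * r ^ n < 1" using r by linarith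
  qed
  have ser: "(\<lambda>j. (r * r ^ n) ^ Suc j / real (Suc j)) sums (- ln (1 - r * r ^ n))" for n
  proof -
    have "\<bar>- (r * r ^ n)\<bar> < 1"
      unfolding abs_minus_cancel using pos[of n] by (metis abs_of_pos)
    hence "(\<lambda>j. - ((r * r^n) ^ j / real j)) sums ln (1 - r * r^n)"
      using ln_series'[of "- (r * r^n)"] by simp
    from sums_minus[OF this] have "(\<lambda>j. (r * r^n) ^ j / real j) sums (- ln (1 - r * r^n))"
      by simp
    \<comment> \<open>The logarithm series is indexed from 0, where division by
      \<open>real 0\<close> contributes 0; dropping that term shifts the index to start at
      1.\<close>
    hence "(\<lambda>j. (r * r^n) ^ Suc j / real (Suc j)) sums (- ln (1 - r * r^n) - (r*r^n) ^ 0 / real 0)"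
      by (subst sums_Suc_iff) simp
    thus ?thesis by simp
  qed
  have "(\<lambda>j. \<Sum>n<N. (r * r ^ n) ^ Suc j / real (Suc j)) sums (\<Sum>n<N. - ln (1 - r * r ^ n))"
    by (intro sums_sum ser)
  moreover have "(\<lambda>j. 1 / real (Suc j) ^ 2 / t) sums (L / t)"
    unfolding L_def by (intro sums_divide summable_sums summable_inverse_squares)
  moreover have "(\<Sum>n<N. (r * r ^ n) ^ Suc j / real (Suc j)) \<le> 1 / real (Suc j) ^ 2 / t" for j
  proof -
    \<comment> \<open>For fixed j the sum over n is geometric: R / (1 - R) = 1 / (exp ((j + 1) t) -
      1) <= 1 / ((j + 1) t). The further 1 / (j + 1) of the logarithm series gives the convergent
      sum of inverse squares.\<close>
    define R where "R = r ^ Suc j"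
    have R: "0 < R" "R < 1" using pos[of j] by (auto simp: R_def)
    have "(\<Sum>n<N. (r * r ^ n) ^ Suc j) = (\<Sum>n<N. R * R ^ n)"
      by (intro sum.cong) (auto simp: R_def power_mult_distrib power_mult[symmetric] mult.commute)
    also have "\<dots> \<le> (\<Sum>n. R * R ^ n)"
      using R by (intro sum_le_suminf) (auto intro!: summable_mult summable_geometric)
    also have "\<dots> = R / (1 - R)"
      using R by (subst suminf_mult) (auto simp: suminf_geometric)
    also have "\<dots> \<le> 1 / (real (Suc j) * t)"
    proof -
      have "R = exp (real (Suc j) * (- t))"
        unfolding R_def r_def by (rule exp_of_nat_mult[symmetric])
      hence "1 / R = exp (real (Suc j) * t)" by (simp add: exp_minus inverse_eq_divide del: of_nat_Suc)
      also have "\<dots> \<ge> 1 + real (Suc j) * t" by (rule exp_ge_add_one_self)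
      finally have *: "1 / R - 1 \<ge> real (Suc j) * t" by linarith
      have pos': "real (Suc j) * t > 0" using assms by (intro mult_pos_pos) auto
      have "R / (1 - R) = 1 / (1 / R - 1)" using R by (simp add: field_simps)
      also have "\<dots> \<le> 1 / (real (Suc j) * t)"
        by (rule divide_left_mono) (use * pos' in \<open>auto intro!: mult_pos_pos simp del: of_nat_Suc\<close>)
      finally show ?thesis .
    qed
    finally have "(\<Sum>n<N. (r * r ^ n) ^ Suc j) / real (Suc j) \<le> 1 / (real (Suc j) * t) / real (Suc j)"
      by (intro divide_right_mono) auto
    thus ?thesis by (simp add: sum_divide_distrib power2_eq_square mult_ac)
  qed
  ultimately have "(\<Sum>n<N. - ln (1 - r * r ^ n)) \<le> L / t"
    by (rule sums_le[rotated 1])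
  hence "- (L / t) \<le> (\<Sum>n<N. ln (1 - r * r ^ n))" by (simp add: sum_negf)
  hence "exp (- (L / t)) \<le> exp (\<Sum>n<N. ln (1 - r * r ^ n))" by simp
  also have "\<dots> = (\<Prod>n<N. 1 - r * r ^ n)"
    by (subst exp_sum) (auto intro!: prod.cong simp: pos)
  finally show ?thesis by (simp add: r_def L_def)
qed

text \<open>The triangle inequality replaces each factor by its value at the positive real point of
  the same modulus. The hypothesis on x is met by q multiplied by any number of modulus 1, hence by
  both factors in the denominator of the crank function.\<close>

lemma norm_qpoch_ge:
  assumes "norm q = exp (-t)" "t > 0" "norm x = norm q"
  shows "norm (qpoch x q) \<ge> exp (- (\<Sum>j. 1 / real (Suc j) ^ 2) / t)"
proof (rule tendsto_lowerbound)
  have q: "norm q < 1" using assms by simp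
  show "(\<lambda>N. norm (\<Prod>n<N. 1 - x * q ^ n)) \<longlonglongrightarrow> norm (qpoch x q)"
    by (intro tendsto_norm qpoch_LIMSEQ q)
  have "norm (\<Prod>n<N. 1 - x * q ^ n) \<ge> exp (- (\<Sum>j. 1 / real (Suc j) ^ 2) / t)" for N
  proof (rule order_trans[OF prod_ge_exp_neg_inverse[OF assms(2)]])
    show "(\<Prod>n<N. 1 - exp (-t) * exp (-t) ^ n) \<le> norm (\<Prod>n<N. 1 - x * q ^ n)"
      unfolding prod_norm[symmetric]
    proof (intro prod_mono conjI)
      fix n
      have "norm (x * q ^ n) = exp (-t) * exp (-t) ^ n"
        using assms by (simp add: norm_mult norm_power)
      moreover have "norm (1 - x * q ^ n) \<ge> norm (1::complex) - norm (x * q ^ n)"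
        by (rule norm_triangle_ineq2)
      ultimately show "1 - exp (-t) * exp (-t) ^ n \<le> norm (1 - x * q ^ n)" by simp
      have "exp (-t) * exp (-t) ^ n \<le> 1 * 1"
        using assms by (intro mult_mono power_le_one) auto
      thus "0 \<le> 1 - exp (-t) * exp (-t) ^ n" by simp
    qed
  qed
  thus "eventually (\<lambda>N. norm (\<Prod>n<N. 1 - x * q ^ n) \<ge> exp (- (\<Sum>j. 1 / real (Suc j) ^ 2) / t)) sequentially"
    by simp
qed auto

section \<open>Theta functions\<close>

lemma lattice_coordinates:
  assumes "Im t > 0"
  obtains a b :: int and x y :: real where "0 \<le> x" "x \<le> 1" "0 \<le> y" "y \<le> 1"
    "u = of_real x + of_real y * t + of_int a + of_int b * t"
proof
  define y x where "y = Im u / Im t" and "x = Re u - y * Re t"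
  show "0 \<le> x - of_int \<lfloor>x\<rfloor>" "x - of_int \<lfloor>x\<rfloor> \<le> 1" "0 \<le> y - of_int \<lfloor>y\<rfloor>" "y - of_int \<lfloor>y\<rfloor> \<le> 1"
    by linarith+
  show "u = of_real (x - of_int \<lfloor>x\<rfloor>) + of_real (y - of_int \<lfloor>y\<rfloor>) * t + of_int \<lfloor>x\<rfloor> + of_int \<lfloor>y\<rfloor> * t"
    using assms by (auto simp: complex_eq_iff x_def y_def algebra_simps)
qed

lemma periodic_int_shift:
  fixes h :: "complex \<Rightarrow> 'a"
  assumes "\<And>u. h (u + w) = h u"
  shows "h (u + of_int n * w) = h u"
proof (induction n arbitrary: u rule: int_induct[where k = 0])
  case (step1 i)
  have "h (u + of_int (i + 1) * w) = h ((u + of_int i * w) + w)" by (simp add: algebra_simps)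
  thus ?case using step1 assms by metis
next
  case (step2 i)
  have "h (u + of_int (i - 1) * w) = h ((u + of_int (i - 1) * w) + w)" using assms by simp
  also have "\<dots> = h (u + of_int i * w)" by (simp add: algebra_simps)
  finally show ?case using step2 by simp
qed auto

lemma entire_elliptic_imp_constant:
  assumes "h holomorphic_on UNIV" "Im t > 0" "\<And>u. h (u + 1) = h u" "\<And>u. h (u + t) = h u"
  shows "\<exists>c. \<forall>u. h u = c"
proof -
  define K where "K = (\<lambda>v::real \<times> real. of_real (fst v) + of_real (snd v) * t) ` cbox (0,0) (1,1)"
  have "compact K" unfolding K_def
    by (intro compact_continuous_image continuous_intros compact_cbox)
  hence "bounded (h ` K)"
    using assms(1) by (meson compact_continuous_image compact_imp_bounded continuous_on_subset
        holomorphic_on_imp_continuous_on subset_UNIV)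
  moreover have "range h \<subseteq> h ` K"
  proof safe
    fix u
    obtain a b x y where *: "0 \<le> x" "x \<le> 1" "0 \<le> y" "y \<le> 1"
      "u = of_real x + of_real y * t + of_int a + of_int b * t"
      using lattice_coordinates[OF assms(2)] by metis
    have "h u = h (of_real x + of_real y * t + of_int a * 1)"
      using periodic_int_shift[of h t _ b] assms(4) * by simp
    also have "\<dots> = h (of_real x + of_real y * t)"
      using periodic_int_shift[of h 1 _ a] assms(3) by simp
    finally show "h u \<in> h ` K" using * by (auto simp: K_def image_iff intro!: bexI[of _ "(x,y)"])
  qed
  ultimately have "bounded (range h)" using bounded_subset by blast
  thus ?thesis using Liouville_theorem[OF assms(1)] by (auto simp: constant_on_def)
qed

lemma quotient_removable_simple_zero:
  assumes "N holomorphic_on UNIV" "D holomorphic_on UNIV" "D v = 0" "N v = 0" "deriv D v \<noteq> 0"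
  shows "\<exists>c. ((\<lambda>u. N u / D u) \<longlongrightarrow> c) (at v)"
proof -
  have N: "(N has_field_derivative deriv N v) (at v)" and D: "(D has_field_derivative deriv D v) (at v)"
    using assms by (auto intro!: holomorphic_derivI[of _ UNIV])
  have "((\<lambda>u. ((N u - N v) / (u - v)) / ((D u - D v) / (u - v))) \<longlongrightarrow> deriv N v / deriv D v) (at v)"
    using N D assms(5) by (intro tendsto_divide) (auto simp: has_field_derivative_iff)
  moreover have "eventually (\<lambda>u. ((N u - N v) / (u - v)) / ((D u - D v) / (u - v)) = N u / D u) (at v)"
    by (auto simp: eventually_at_filter assms(3,4))
  ultimately have "((\<lambda>u. N u / D u) \<longlongrightarrow> deriv N v / deriv D v) (at v)"
    by (rule Lim_transform_eventually)
  thus ?thesis ..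
qed

text \<open>The common multipliers cancel in N / D, and since the zeros of D are simple and shared
  by N, every singularity of the quotient is removable. What remains is an entire elliptic
  function.\<close>

lemma theta_function_unique:
  assumes hol: "N holomorphic_on UNIV" "D holomorphic_on UNIV" and t: "Im t > 0"
    and one: "\<And>u. N (u + 1) = m1 u * N u" "\<And>u. D (u + 1) = m1 u * D u"
    and tau: "\<And>u. N (u + t) = m2 u * N u" "\<And>u. D (u + t) = m2 u * D u"
    and nz: "\<And>u. m1 u \<noteq> 0" "\<And>u. m2 u \<noteq> 0"
    and zeros: "\<And>u. D u = 0 \<Longrightarrow> N u = 0 \<and> deriv D u \<noteq> 0"
  shows "\<exists>c. \<forall>u. N u = c * D u"
proof -
  \<comment> \<open>If D vanished identically, its derivative would too, against the hypothesis on
    zeros. A nonzero value makes the zeros isolated.\<close>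
  obtain b where b: "D b \<noteq> 0"
  proof (rule ccontr)
    assume "\<not> thesis"
    hence "D = (\<lambda>_. 0)" using that by auto
    with zeros show False by simp
  qed
  define h where "h = (\<lambda>u. N u / D u)"
  have ana: "h analytic_on {u}" if "D u \<noteq> 0" for u
    using that hol unfolding h_def
    by (intro analytic_intros) (auto intro: holomorphic_on_imp_analytic_at)
  have "remove_sings h analytic_on {v}" for v
  proof -
    have "eventually (\<lambda>w. D w \<noteq> 0 \<and> w \<in> UNIV) (at v)"
      using non_zero_neighbour_alt[OF hol(2) open_UNIV connected_UNIV, of v b] b by auto
    then obtain r where r: "r > 0" "\<And>w. w \<in> ball v r - {v} \<Longrightarrow> D w \<noteq> 0"
      by (auto simp: eventually_at dist_commute)
    have "h analytic_on ball v r - {v}"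
      using r ana analytic_on_analytic_at by blast
    hence iso: "isolated_singularity_at h v" using r by (auto simp: isolated_singularity_at_def)
    show ?thesis
    proof (cases "D v = 0")
      case True
      with zeros obtain c where "(h \<longlongrightarrow> c) (at v)"
        unfolding h_def using quotient_removable_simple_zero[OF hol] by blast
      with iso show ?thesis by (rule remove_sings_analytic_at)
    next
      case False
      thus ?thesis using ana remove_sings_analytic_on by blast
    qed
  qed
  hence hol': "remove_sings h holomorphic_on UNIV"
    using analytic_imp_holomorphic analytic_on_analytic_at by blast
  \<comment> \<open>\<open>remove_sings\<close> is determined by limits, so it inherits the periods
    of h.\<close>
  have per: "remove_sings h (u + w) = remove_sings h u" if "\<And>u. h (u + w) = h u" for u w
    using that by (simp add: remove_sings_shift_0[of h "u + w"] remove_sings_shift_0[of h u] algebra_simps)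
      (metis add.commute add.left_commute)
  obtain c where c: "\<And>u. remove_sings h u = c"
    using entire_elliptic_imp_constant[OF hol' t per per] nz
    by (force simp: h_def one tau)
  have "N u = c * D u" for u
  proof (cases "D u = 0")
    case False
    have "h u = c" using c[of u] ana[OF False] by simp
    with False show ?thesis by (simp add: h_def field_simps)
  qed (use zeros in auto)
  thus ?thesis by blast
qed

section \<open>The exponential and the Jacobi theta function\<close>

definition ecis :: "complex \<Rightarrow> complex" where
  "ecis z = exp (2 * pi * \<i> * z)"

lemma ecis_0 [simp]: "ecis 0 = 1"
  by (simp add: ecis_def)

lemma ecis_nonzero [simp]: "ecis z \<noteq> 0"
  by (simp add: ecis_def)

lemma ecis_add: "ecis (x + y) = ecis x * ecis y"
  by (simp add: ecis_def ring_distribs exp_add)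

lemma ecis_diff: "ecis (x - y) = ecis x / ecis y"
  by (simp add: ecis_def ring_distribs exp_diff)

lemma ecis_minus: "ecis (-x) = inverse (ecis x)"
  by (simp add: ecis_def exp_minus)

lemma ecis_power: "ecis x ^ n = ecis (of_nat n * x)"
  by (simp add: ecis_def exp_of_nat_mult[symmetric] mult_ac)

lemma ecis_of_int [simp]: "ecis (of_int n) = 1"
  by (auto simp: ecis_def exp_eq_1)

lemma ecis_of_nat [simp]: "ecis (of_nat n) = 1"
  using ecis_of_int[of "int n"] by (simp del: ecis_of_int)

lemma ecis_1 [simp]: "ecis 1 = 1"
  using ecis_of_int[of 1] by (simp del: ecis_of_int)

lemma ecis_half [simp]: "ecis (1 / 2) = -1"
  by (simp add: ecis_def)

lemma ecis_eq_1_iff: "ecis x = 1 \<longleftrightarrow> (\<exists>n::int. x = of_int n)"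
proof
  assume "ecis x = 1"
  then obtain n :: int where "Im (2 * pi * \<i> * x) = of_int (2 * n) * pi" "Re (2 * pi * \<i> * x) = 0"
    by (auto simp: ecis_def exp_eq_1)
  hence "x = of_int n" by (auto simp: complex_eq_iff)
  thus "\<exists>n::int. x = of_int n" ..
qed auto

lemma ecis_eqI: "x = y + of_int n \<Longrightarrow> ecis x = ecis y"
  by (simp add: ecis_add)

lemma ecis_mult_eqD: "ecis x * a = ecis y * b \<Longrightarrow> b = ecis (x - y) * a"
  by (simp add: ecis_diff field_simps)

lemma norm_ecis: "norm (ecis z) = exp (- 2 * pi * Im z)"
  by (simp add: ecis_def)

lemma norm_ecis_less_1: "Im z > 0 \<Longrightarrow> norm (ecis z) < 1"
  by (simp add: norm_ecis)

lemma holomorphic_ecis [holomorphic_intros]: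
  "f holomorphic_on A \<Longrightarrow> (\<lambda>z. ecis (f z)) holomorphic_on A"
  unfolding ecis_def by (intro holomorphic_intros)

text \<open>Iterates the two multipliers of index k / 2; it is applied with k = 1 to
  \<open>theta\<close> and with k = 3 to the series of the quintuple product. The cross term
  \<open>k * of_int a * of_int b\<close> appears because the t-shifts are applied at the point
  already moved by a.\<close>

lemma quasi_periodic_lattice:
  fixes F :: "complex \<Rightarrow> complex" and k t :: complex
  assumes one: "\<And>u. F (u + 1) = ecis (k / 2) * F u"
    and tau: "\<And>u. F (u + t) = ecis (k * (1 / 2 - u - t / 2)) * F u"
  shows "F (u + of_int a + of_int b * t) =
           ecis (k * ((of_int a + of_int b) / 2 - of_int b * u - of_int b ^ 2 * t / 2)
              - k * of_int a * of_int b) * F u"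
proof -
  have A: "F (u + of_int a) = ecis (k * of_int a / 2) * F u" for u
  proof (induction a rule: int_induct[where k = 0])
    case (step1 i)
    have "F (u + of_int (i + 1)) = F ((u + of_int i) + 1)" by (simp add: add_ac)
    also have "\<dots> = ecis (k * of_int (i + 1) / 2) * F u"
      by (simp only: one step1.IH) (simp add: ecis_add[symmetric] algebra_simps add_divide_distrib)
    finally show ?case .
  next
    case (step2 i)
    have "ecis (k * of_int i / 2) * F u = F ((u + of_int (i - 1)) + 1)" by (simp add: step2.IH)
    also have "\<dots> = ecis (k / 2) * F (u + of_int (i - 1))" by (rule one)
    finally have "F (u + of_int (i - 1)) = ecis (k * of_int i / 2) / ecis (k / 2) * F u"
      by (simp add: field_simps)
    thus ?case by (simp add: ecis_diff[symmetric] algebra_simps diff_divide_distrib)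
  qed auto
  have B: "F (u + of_int b * t) = ecis (k * (of_int b / 2 - of_int b * u - of_int b ^ 2 * t / 2)) * F u" for u
  proof (induction b rule: int_induct[where k = 0])
    case (step1 i)
    have "F (u + of_int (i + 1) * t) = F ((u + of_int i * t) + t)" by (simp add: algebra_simps)
    also have "\<dots> = ecis (k * (1 / 2 - (u + of_int i * t) - t / 2)
        + k * (of_int i / 2 - of_int i * u - of_int i ^ 2 * t / 2)) * F u"
      by (simp only: tau step1.IH) (simp add: ecis_add)
    also have "k * (1 / 2 - (u + of_int i * t) - t / 2) + k * (of_int i / 2 - of_int i * u - of_int i ^ 2 * t / 2)
       = k * (of_int (i + 1) / 2 - of_int (i + 1) * u - of_int (i + 1) ^ 2 * t / 2)"
      by (simp add: field_simps power2_eq_square)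
    finally show ?case .
  next
    case (step2 i)
    have "ecis (k * (of_int i / 2 - of_int i * u - of_int i ^ 2 * t / 2)) * F u = F ((u + of_int (i - 1) * t) + t)"
      by (simp only: step2.IH[symmetric]) (simp add: algebra_simps)
    also have "\<dots> = ecis (k * (1 / 2 - (u + of_int (i - 1) * t) - t / 2)) * F (u + of_int (i - 1) * t)"
      by (rule tau)
    finally have "F (u + of_int (i - 1) * t) = ecis (k * (of_int i / 2 - of_int i * u - of_int i ^ 2 * t / 2)
        - k * (1 / 2 - (u + of_int (i - 1) * t) - t / 2)) * F u"
      by (rule ecis_mult_eqD)
    also have "k * (of_int i / 2 - of_int i * u - of_int i ^ 2 * t / 2) - k * (1 / 2 - (u + of_int (i - 1) * t) - t / 2)
       = k * (of_int (i - 1) / 2 - of_int (i - 1) * u - of_int (i - 1) ^ 2 * t / 2)"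
      by (simp add: field_simps power2_eq_square)
    finally show ?case .
  qed auto
  have "F (u + of_int a + of_int b * t) =
     ecis (k * (of_int b / 2 - of_int b * (u + of_int a) - of_int b ^ 2 * t / 2) + k * of_int a / 2) * F u"
    by (simp only: B A) (simp add: ecis_add)
  also have "k * (of_int b / 2 - of_int b * (u + of_int a) - of_int b ^ 2 * t / 2) + k * of_int a / 2 =
     k * ((of_int a + of_int b) / 2 - of_int b * u - of_int b ^ 2 * t / 2) - k * of_int a * of_int b"
    by (simp add: field_simps power2_eq_square)
  finally show ?thesis .
qed

text \<open>Up to the factor \<open>2 \<pi> \<i>\<close> this is the Weierstrass-normalised Jacobi theta function
  \<open>\<theta>\<^sub>1(u; t) / \<theta>\<^sub>1'(0; t)\<close>, which has weight \<open>-1\<close> and index \<open>1/2\<close>.\<close>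
definition theta :: "complex \<Rightarrow> complex \<Rightarrow> complex" where
  "theta u t = (ecis (u / 2) - ecis (- u / 2)) * qpoch (ecis (t + u)) (ecis t) *
     qpoch (ecis (t - u)) (ecis t) / qpoch (ecis t) (ecis t) ^ 2"

lemma qpoch_ecis_nonzero: "Im t > 0 \<Longrightarrow> qpoch (ecis t) (ecis t) \<noteq> 0"
  by (intro qpoch_nonzero norm_ecis_less_1)

context
  fixes t :: complex
  assumes t: "Im t > 0"
begin

lemma holomorphic_theta: "(\<lambda>u. theta u t) holomorphic_on UNIV"
  unfolding theta_def using norm_ecis_less_1[OF t] qpoch_ecis_nonzero[OF t]
  by (intro holomorphic_intros) auto

lemma theta_0 [simp]: "theta 0 t = 0"
  by (simp add: theta_def)

lemma theta_plus_1: "theta (u + 1) t = - theta u t"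
proof -
  have "(u + 1) / 2 = u / 2 + 1 / 2" "- (u + 1) / 2 = - u / 2 - 1 / 2"
    by (simp_all add: field_simps)
  hence "ecis ((u + 1) / 2) = - ecis (u / 2)" "ecis (- (u + 1) / 2) = - ecis (- u / 2)"
    by (simp_all only: ecis_add ecis_diff ecis_half) simp_all
  moreover have "ecis (t + (u + 1)) = ecis (t + u)"
    by (rule ecis_eqI[of _ _ 1]) simp
  moreover have "ecis (t - (u + 1)) = ecis (t - u)"
    by (rule ecis_eqI[of _ _ "-1"]) simp
  moreover have "(- a - - b) * P * Q / C = - ((a - b) * P * Q / C)" for a b P Q C :: complex
    by (simp add: algebra_simps diff_divide_distrib)
  ultimately show ?thesis unfolding theta_def by metis
qed

text \<open>The shift removes the factor 1 - ecis (u + t) from one product and adds 1 - ecis (-u) to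
  the other; the rest is algebra in the square roots \<open>y\<close> and \<open>r\<close>.\<close>

lemma theta_plus_tau: "theta (u + t) t = ecis (1 / 2 - u - t / 2) * theta u t"
proof -
  define q y r where "q = ecis t" and "y = ecis (u / 2)" and "r = ecis (t / 2)"
  note q = norm_ecis_less_1[OF t, folded q_def]
  have nz: "y \<noteq> 0" "r \<noteq> 0" by (auto simp: y_def r_def)
  have r2: "q = r ^ 2" and y2: "ecis u = y ^ 2" by (simp_all add: y_def q_def r_def ecis_power)
  have "ecis ((u + t) / 2) = y * r" "ecis (- (u + t) / 2) = inverse (y * r)"
    by (simp_all add: y_def r_def ecis_add[symmetric] ecis_minus[symmetric] add_divide_distrib diff_divide_distrib)
  moreover have "ecis (t + (u + t)) = y ^ 2 * q * q" "ecis (t - (u + t)) = inverse (y ^ 2)"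
    by (simp only: y2[symmetric] q_def ecis_add mult_ac) (simp add: y2[symmetric] ecis_minus)
  ultimately have 1: "theta (u + t) t =
      (y * r - inverse (y * r)) * qpoch (y ^ 2 * q * q) q * qpoch (inverse (y ^ 2)) q / qpoch q q ^ 2"
    by (simp only: theta_def q_def[symmetric])
  have "ecis (- u / 2) = inverse y"
    using ecis_minus[of "u / 2"] by (simp add: y_def)
  moreover have "ecis (t + u) = y ^ 2 * q" "ecis (t - u) = inverse (y ^ 2) * q"
    by (simp_all add: y2[symmetric] q_def ecis_add ecis_diff divide_inverse)
  ultimately have 2: "theta u t = (y - inverse y) * qpoch (y ^ 2 * q) q * qpoch (inverse (y ^ 2) * q) q / qpoch q q ^ 2"
    by (simp only: theta_def q_def[symmetric] y_def[symmetric])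
  have 3: "ecis (1 / 2 - u - t / 2) = - inverse (y ^ 2) * inverse r"
    by (simp only: ecis_diff y2 r_def ecis_half) (simp add: divide_simps)
  have "(y * r - inverse (y * r)) * P * ((1 - inverse (y ^ 2)) * R) / C =
      - inverse (y ^ 2) * inverse r * ((y - inverse y) * ((1 - y ^ 2 * q) * P) * R / C)" for P R C :: complex
  proof -
    have "(y * r - inverse (y * r)) * (1 - inverse (y ^ 2)) =
      - inverse (y ^ 2) * inverse r * ((y - inverse y) * (1 - y ^ 2 * q))"
      unfolding r2 using nz by (simp add: field_simps power2_eq_square)
    hence "(y * r - inverse (y * r)) * (1 - inverse (y ^ 2)) * (P * R / C) =
      - inverse (y ^ 2) * inverse r * ((y - inverse y) * (1 - y ^ 2 * q)) * (P * R / C)" by simp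
    thus ?thesis by (simp only: mult_ac times_divide_eq_right times_divide_eq_left)
  qed
  thus ?thesis
    unfolding 1 2 3 qpoch_rec[OF q, of "y ^ 2 * q"] qpoch_rec[OF q, of "inverse (y ^ 2)"] by blast
qed

lemma theta_lattice:
  "theta (u + of_int a + of_int b * t) t =
     ecis ((of_int a + of_int b) / 2 - of_int b * u - of_int b ^ 2 * t / 2) * theta u t"
proof -
  have "theta (u + of_int a + of_int b * t) t = 
     ecis (1 * ((of_int a + of_int b) / 2 - of_int b * u - of_int b ^ 2 * t / 2) - 1 * of_int a * of_int b) * theta u t"
    by (rule quasi_periodic_lattice[of "\<lambda>u. theta u t"]) (auto simp: theta_plus_1 theta_plus_tau)
  also have "ecis (1 * ((of_int a + of_int b) / 2 - of_int b * u - of_int b ^ 2 * t / 2) - 1 * of_int a * of_int b)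
    = ecis ((of_int a + of_int b) / 2 - of_int b * u - of_int b ^ 2 * t / 2)"
    by (rule ecis_eqI[of _ _ "- a * b"]) simp
  finally show ?thesis .
qed

lemma theta_eq_0_iff: "theta u t = 0 \<longleftrightarrow> (\<exists>a b::int. u = of_int a + of_int b * t)"
proof
  assume "theta u t = 0"
  then consider "ecis (u / 2) = ecis (- u / 2)" | "qpoch (ecis (t + u)) (ecis t) = 0"
    | "qpoch (ecis (t - u)) (ecis t) = 0"
    using qpoch_ecis_nonzero[OF t] by (auto simp: theta_def)
  thus "\<exists>a b::int. u = of_int a + of_int b * t"
  proof cases
    case 1
    hence "ecis (u / 2 - (- u / 2)) = 1" by (simp only: ecis_diff) simp
    then obtain n where "u = of_int n" by (auto simp: ecis_eq_1_iff)
    thus ?thesis by (intro exI[of _ n] exI[of _ 0]) auto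
  next
    case 2
    then obtain n where "ecis (t + u) * ecis t ^ n = 1"
      using qpoch_eq_0_iff[OF norm_ecis_less_1[OF t]] by auto
    hence "ecis (t + u + of_nat n * t) = 1" by (simp add: ecis_power ecis_add)
    then obtain a :: int where "t + u + of_nat n * t = of_int a" by (auto simp: ecis_eq_1_iff)
    hence "u = of_int a + of_int (- int n - 1) * t" by (simp add: algebra_simps)
    thus ?thesis by blast
  next
    case 3
    then obtain n where "ecis (t - u) * ecis t ^ n = 1"
      using qpoch_eq_0_iff[OF norm_ecis_less_1[OF t]] by auto
    hence "ecis (t - u + of_nat n * t) = 1" by (simp add: ecis_power ecis_add ecis_diff)
    then obtain a :: int where "t - u + of_nat n * t = of_int a" by (auto simp: ecis_eq_1_iff)
    hence "u = of_int (-a) + of_int (int n + 1) * t" by (simp add: algebra_simps)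
    thus ?thesis by blast
  qed
next
  assume "\<exists>a b::int. u = of_int a + of_int b * t"
  thus "theta u t = 0" using theta_lattice[of 0] by auto
qed

text \<open>Dividing by \<open>qpoch (ecis t) (ecis t) ^ 2\<close> makes this derivative independent
  of t. Comparing derivatives at 0 then fixes the constants left open by Liouville's
  theorem.\<close>

lemma has_field_derivative_theta_0: "((\<lambda>u. theta u t) has_field_derivative 2 * pi * \<i>) (at 0)"
proof -
  define P where "P = (\<lambda>u. qpoch (ecis (t + u)) (ecis t) * qpoch (ecis (t - u)) (ecis t) / qpoch (ecis t) (ecis t) ^ 2)"
  have "P holomorphic_on UNIV"
    unfolding P_def using norm_ecis_less_1[OF t] qpoch_ecis_nonzero[OF t]
    by (intro holomorphic_intros) auto
  hence "(P has_field_derivative deriv P 0) (at 0)" by (auto intro!: holomorphic_derivI[of _ UNIV])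
  moreover have "((\<lambda>u. ecis (u / 2) - ecis (- u / 2)) has_field_derivative 2 * pi * \<i>) (at 0)"
    unfolding ecis_def by (auto intro!: derivative_eq_intros)
  ultimately have "((\<lambda>u. (ecis (u / 2) - ecis (- u / 2)) * P u) has_field_derivative 2 * pi * \<i> * P 0) (at 0)"
    using DERIV_mult by fastforce
  moreover have "P 0 = 1" using qpoch_ecis_nonzero[OF t] by (simp add: P_def power2_eq_square)
  ultimately show ?thesis by (simp add: theta_def[abs_def] P_def mult.assoc)
qed

text \<open>The zero at 0 is simple, and quasi-periodicity with its nonvanishing multiplier carries
  this to every lattice point.\<close>

lemma deriv_theta_nonzero:
  assumes "theta u t = 0"
  shows "deriv (\<lambda>u. theta u t) u \<noteq> 0"
proof -
  obtain a b :: int where u: "u = of_int a + of_int b * t" using assms theta_eq_0_iff by auto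
  define m where "m = (\<lambda>u. ecis ((of_int a + of_int b) / 2 - of_int b * u - of_int b ^ 2 * t / 2))"
  have "m holomorphic_on UNIV" unfolding m_def by (intro holomorphic_intros)
  hence "(m has_field_derivative deriv m 0) (at 0)" by (auto intro!: holomorphic_derivI[of _ UNIV])
  hence "((\<lambda>v. m v * theta v t) has_field_derivative m 0 * (2 * pi * \<i>)) (at 0)"
    using DERIV_mult[OF _ has_field_derivative_theta_0, of m "deriv m 0"] by (simp add: mult_ac)
  also have "(\<lambda>v. m v * theta v t) = (\<lambda>v. theta (v + u) t)"
    by (auto simp: fun_eq_iff m_def u theta_lattice[symmetric] add_ac)
  finally have "((\<lambda>v. theta v t) has_field_derivative m 0 * (2 * pi * \<i>)) (at u)"
    using DERIV_shift[of "\<lambda>v. theta v t" "m 0 * (2 * pi * \<i>)" 0 u] by simp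
  hence "deriv (\<lambda>u. theta u t) u = m 0 * (2 * pi * \<i>)" by (rule DERIV_imp_deriv)
  thus ?thesis by (simp add: m_def)
qed

end

section \<open>Modular transformation of theta and of its torsion values\<close>

lemma moebius_denominator_nonzero:
  fixes a b c d :: int
  assumes "a * d - b * c = 1" "Im t > 0"
  shows "of_int c * t + of_int d \<noteq> (0 :: complex)"
proof
  assume *: "of_int c * t + of_int d = (0 :: complex)"
  hence "of_int c * Im t = 0" by (auto simp: complex_eq_iff)
  hence "c = 0" using assms by simp
  with * have "d = 0" by simp
  with \<open>c = 0\<close> assms show False by simp
qed

lemma Im_moebius:
  fixes a b c d :: int
  assumes "a * d - b * c = 1" "Im t > 0"
  shows "Im ((of_int a * t + of_int b) / (of_int c * t + of_int d)) =
           Im t / norm (of_int c * t + of_int d) ^ 2"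
proof -
  have "of_int a * of_int d - of_int b * of_int c = (1 :: real)"
    using assms(1) by (simp flip: of_int_mult of_int_diff)
  hence "Im t * (of_int a * of_int d - of_int b * of_int c) = Im t" by simp
  thus ?thesis
    by (simp add: Im_divide cmod_power2 algebra_simps)
qed

lemma Im_moebius_pos:
  fixes a b c d :: int
  assumes "a * d - b * c = 1" "Im t > 0"
  shows "Im ((of_int a * t + of_int b) / (of_int c * t + of_int d)) > 0"
  using assms moebius_denominator_nonzero[OF assms] by (simp add: Im_moebius)

text \<open>Both sides have the same quasi-periods and zeros as functions of \<open>u\<close>.\<close>
lemma theta_modular:
  fixes a b c d :: int
  assumes det: "a * d - b * c = 1" and t: "Im t > 0"
  defines "J \<equiv> of_int c * t + of_int d"
  defines "s \<equiv> (of_int a * t + of_int b) / J"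
  shows "theta (u / J) s = inverse J * ecis (of_int c * u ^ 2 / (2 * J)) * theta u t"
proof -
  have J: "J \<noteq> 0" using moebius_denominator_nonzero[OF det t] by (simp add: J_def)
  have s: "Im s > 0" using Im_moebius_pos[OF det t] by (simp add: s_def J_def)
  have det': "of_int a * of_int d - of_int b * of_int c = (1 :: complex)"
    using det by (simp flip: of_int_mult of_int_diff)
  \<comment> \<open>Together with \<open>tau\<close> below: after division by J the periods 1 and t
    are integral combinations of 1 and s, so \<open>theta_lattice\<close> at s applies to both
    shifts.\<close>
  have one: "1 / J = of_int a - of_int c * s"
  proof -
    have "of_int a * J - of_int c * (of_int a * t + of_int b) = 1"
      using det' by (simp add: J_def algebra_simps)
    thus ?thesis using J by (simp add: s_def field_simps)
  qed
  have tau: "t / J = of_int d * s - of_int b"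
  proof -
    have "of_int d * (of_int a * t + of_int b) - of_int b * J = t * (of_int a * of_int d - of_int b * of_int c)"
      by (simp add: J_def algebra_simps)
    hence "of_int d * (of_int a * t + of_int b) - of_int b * J = t" by (simp only: det' mult_1_right)
    thus ?thesis using J by (simp add: s_def field_simps)
  qed
  \<comment> \<open>The Gaussian factor is chosen to restore exactly the multipliers of
    \<open>theta u t\<close>.\<close>
  define N where "N = (\<lambda>u. theta (u / J) s * ecis (- (of_int c * u ^ 2 / (2 * J))))"
  \<comment> \<open>Modulo 2 these are (a + 1)(c + 1) and (b + 1)(d + 1); an odd determinant
    excludes that both entries of a column are even. They decide that the signs from
    \<open>theta_lattice\<close> come out as ecis (1 / 2) = -1.\<close>
  have parity: "even (a - c - a * c - 1)" "even (d - b - b * d - 1)"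
    using arg_cong[OF det, of even] by auto
  have "\<exists>k. \<forall>u. N u = k * theta u t"
  proof (rule theta_function_unique[OF _ _ t, where ?m1.0 = "\<lambda>u. ecis (1 / 2)" and ?m2.0 = "\<lambda>u. ecis (1 / 2 - u - t / 2)"])
    have "((\<lambda>u. theta u s) \<circ> (\<lambda>u. u / J)) holomorphic_on UNIV"
      by (rule holomorphic_on_compose_gen[OF _ holomorphic_theta[OF s]]) (use J in \<open>auto intro!: holomorphic_intros\<close>)
    thus "N holomorphic_on UNIV"
      unfolding N_def using J by (intro holomorphic_intros) (auto simp: o_def)
    show "(\<lambda>u. theta u t) holomorphic_on UNIV" by (rule holomorphic_theta[OF t])
    show "theta (u + 1) t = ecis (1 / 2) * theta u t" for u by (simp add: theta_plus_1[OF t])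
    show "theta (u + t) t = ecis (1 / 2 - u - t / 2) * theta u t" for u by (rule theta_plus_tau[OF t])
    show "N (u + 1) = ecis (1 / 2) * N u" for u
    proof -
      obtain k where k: "a - c - a * c - 1 = 2 * k" using parity by blast
      have "(u + 1) / J = u / J + of_int a + of_int (- c) * s"
        using one by (simp add: add_divide_distrib)
      hence "N (u + 1) = ecis ((of_int a + of_int (-c)) / 2 - of_int (-c) * (u / J) - of_int (-c) ^ 2 * s / 2
          + - (of_int c * (u + 1) ^ 2 / (2 * J))) * theta (u / J) s"
        by (simp only: N_def theta_lattice[OF s] ecis_add) (simp only: mult_ac)
      also have "(of_int a + of_int (-c)) / 2 - of_int (-c) * (u / J) - of_int (-c) ^ 2 * s / 2
          + - (of_int c * (u + 1) ^ 2 / (2 * J)) =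
          (of_int a - of_int c) / 2 - of_int c * (of_int c * s + 1 / J) / 2 + - (of_int c * u ^ 2 / (2 * J))"
        using J by (simp add: field_simps power2_eq_square)
      also have "of_int c * s + 1 / J = of_int a" using one by simp
      also have "(of_int a - of_int c) / 2 - of_int c * of_int a / 2 = (of_int a - of_int c - of_int a * of_int c) / (2 :: complex)"
        by (simp add: field_simps)
      also have "of_int a - of_int c - of_int a * of_int c = (1 + 2 * of_int k :: complex)"
        using arg_cong[OF k, of "of_int :: int \<Rightarrow> complex"] by (simp add: algebra_simps)
      also have "(1 + 2 * of_int k) / 2 = (1 / 2 + of_int k :: complex)"
        by (simp add: add_divide_distrib)
      also have "ecis (1 / 2 + of_int k + - (of_int c * u ^ 2 / (2 * J))) * theta (u / J) s = ecis (1 / 2) * N u"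
        by (simp only: N_def ecis_add ecis_of_int mult_ac mult_1_left mult_1_right)
      finally show ?thesis .
    qed
    show "N (u + t) = ecis (1 / 2 - u - t / 2) * N u" for u
    proof -
      obtain k where k: "d - b - b * d - 1 = 2 * k" using parity by blast
      have "(u + t) / J = u / J + of_int (- b) + of_int d * s"
        using tau by (simp add: add_divide_distrib)
      hence "N (u + t) = ecis ((of_int (-b) + of_int d) / 2 - of_int d * (u / J) - of_int d ^ 2 * s / 2
          + - (of_int c * (u + t) ^ 2 / (2 * J))) * theta (u / J) s"
        by (simp only: N_def theta_lattice[OF s] ecis_add) (simp only: mult_ac)
      also have "(of_int (-b) + of_int d) / 2 - of_int d * (u / J) - of_int d ^ 2 * s / 2
          + - (of_int c * (u + t) ^ 2 / (2 * J)) =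
          (of_int d - of_int b) / 2 - (of_int c * t + of_int d) * u / J 
            - of_int d * (of_int d * s) / 2 - of_int c * t * (t / J) / 2 + - (of_int c * u ^ 2 / (2 * J))"
        using J by (simp add: field_simps power2_eq_square)
      also have "of_int d * s = t / J + of_int b" using tau by simp
      also have "(of_int d - of_int b) / 2 - (of_int c * t + of_int d) * u / J 
            - of_int d * (t / J + of_int b) / 2 - of_int c * t * (t / J) / 2 =
           (of_int d - of_int b - of_int b * of_int d) / 2 - (of_int c * t + of_int d) * u / J
            - (of_int c * t + of_int d) * t / J / 2"
        using J by (simp add: field_simps)
      also have "of_int d - of_int b - of_int b * of_int d = (1 + 2 * of_int k :: complex)"
        using arg_cong[OF k, of "of_int :: int \<Rightarrow> complex"] by (simp add: algebra_simps)
      also have "(1 + 2 * of_int k) / 2 = (1 / 2 + of_int k :: complex)"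
        by (simp add: add_divide_distrib)
      also have "(of_int c * t + of_int d) * u / J = u" using J by (simp add: J_def)
      also have "(of_int c * t + of_int d) * t / J = t" using J by (simp add: J_def)
      also have "1 / 2 + of_int k - u - t / 2 + - (of_int c * u ^ 2 / (2 * J)) =
          (1 / 2 - u - t / 2) + of_int k + - (of_int c * u ^ 2 / (2 * J))" by simp
      also have "ecis \<dots> * theta (u / J) s = ecis (1 / 2 - u - t / 2) * N u"
        by (simp only: N_def ecis_add ecis_of_int mult_ac mult_1_left mult_1_right)
      finally show ?thesis .
    qed
    show "N u = 0 \<and> deriv (\<lambda>u. theta u t) u \<noteq> 0" if zero: "theta u t = 0" for u
    proof
      obtain x y :: int where "u = of_int x + of_int y * t" using zero theta_eq_0_iff[OF t] by auto
      hence "u / J = of_int x * (1 / J) + of_int y * (t / J)" by (simp add: add_divide_distrib)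
      also have "\<dots> = of_int (x * a - y * b) + of_int (y * d - x * c) * s"
        by (simp add: one tau algebra_simps)
      finally have "theta (u / J) s = 0" using theta_eq_0_iff[OF s] by blast
      thus "N u = 0" by (simp add: N_def)
    qed (rule deriv_theta_nonzero[OF t zero])
  qed auto
  then obtain k where k: "\<And>u. N u = k * theta u t" by blast
  have "k = inverse J"
  proof -
    have dt: "((\<lambda>u. theta u s) has_field_derivative 2 * pi * \<i>) (at (0 / J))"
      using has_field_derivative_theta_0[OF s] by simp
    have "((\<lambda>u. u / J) has_field_derivative inverse J) (at 0)"
      using J by (auto intro!: derivative_eq_intros simp: field_simps)
    from DERIV_chain2[OF dt this]
    have 1: "((\<lambda>u. theta (u / J) s) has_field_derivative 2 * pi * \<i> * inverse J) (at 0)" .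
    define E where "E = (\<lambda>u. ecis (- (of_int c * u ^ 2 / (2 * J))))"
    have "E holomorphic_on UNIV" unfolding E_def using J by (intro holomorphic_intros) auto
    hence "(E has_field_derivative deriv E 0) (at 0)" by (auto intro!: holomorphic_derivI[of _ UNIV])
    from DERIV_mult[OF 1 this] have "(N has_field_derivative 2 * pi * \<i> * inverse J) (at 0)"
      by (simp add: N_def E_def s theta_0)
    moreover have "(N has_field_derivative k * (2 * pi * \<i>)) (at 0)"
      unfolding k by (rule DERIV_cmult[OF has_field_derivative_theta_0[OF t]])
    ultimately have "2 * pi * \<i> * inverse J = k * (2 * pi * \<i>)" by (rule DERIV_unique)
    thus ?thesis by simp
  qed
  with k[of u] have "theta (u / J) s * ecis (- (of_int c * u ^ 2 / (2 * J))) = inverse J * theta u t"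
    by (simp add: N_def)
  thus ?thesis using J by (simp add: ecis_minus field_simps)
qed

text \<open>For w = k / p the congruences make w J a lattice translate of w, namely w + k f + p k e
  t. The multiplier of this translation and the Gaussian from \<open>theta_modular\<close> cancel up
  to \<open>ecis\<close> of an integer.\<close>

lemma theta_torsion_modular:
  fixes a b c d k :: int and p :: nat
  assumes det: "a * d - b * c = 1" and t: "Im t > 0" and p: "odd p"
    and c: "int p ^ 2 dvd c" and d: "d mod int p = 1 mod int p"
  defines "J \<equiv> of_int c * t + of_int d"
  shows "theta (of_int k / of_nat p) ((of_int a * t + of_int b) / J) =
           inverse J * theta (of_int k / of_nat p) t"
proof -
  have J: "J \<noteq> 0" using moebius_denominator_nonzero[OF det t] by (simp add: J_def)
  obtain e where e: "c = int p ^ 2 * e" using c by blast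
  obtain f where f: "d = 1 + int p * f" using d by (metis mod_eqE add.commute diff_eq_eq mod_eq_dvd_iff dvdE)
  have p0: "p \<noteq> 0" using p by (auto intro: Nat.gr0I)
  define P where "P = (of_nat p :: complex)"
  have P: "P \<noteq> 0" using p0 by (simp add: P_def)
  have cP: "of_int c = P ^ 2 * of_int e" and dP: "of_int d = 1 + P * of_int f"
    by (simp_all add: e f P_def)
  define w where "w = of_int k / P"
  \<comment> \<open>As p is odd, modulo 2 this is k f (1 + e). If f is odd then d is even, so c must
    be odd, and with it e.\<close>
  have even: "even (k * f + int p * k * e + k ^ 2 * e * (d - 2))"
    using arg_cong[OF det, of even] p by (auto simp: e f)
  then obtain l where l: "k * f + int p * k * e + k ^ 2 * e * (d - 2) = 2 * l" by blast
  have "w * J = w + of_int (k * f) + of_int (int p * k * e) * t"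
    using P by (simp add: J_def cP dP w_def P_def[symmetric] field_simps power2_eq_square)
  hence 1: "theta (w * J) t = ecis ((of_int (k * f) + of_int (int p * k * e)) / 2 - of_int (int p * k * e) * w
          - of_int (int p * k * e) ^ 2 * t / 2) * theta w t"
    by (simp only: theta_lattice[OF t])
  have "theta (w * J / J) ((of_int a * t + of_int b) / J) =
      inverse J * ecis (of_int c * (w * J) ^ 2 / (2 * J)) * theta (w * J) t"
    unfolding J_def by (rule theta_modular[OF det t])
  also have "of_int c * (w * J) ^ 2 / (2 * J) = of_int c * w ^ 2 * (of_int c * t + of_int d) / 2"
    unfolding J_def[symmetric] using J by (simp add: field_simps power2_eq_square)
  also have "inverse J * ecis (of_int c * w ^ 2 * (of_int c * t + of_int d) / 2) * theta (w * J) t =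
     inverse J * ecis (of_int c * w ^ 2 * (of_int c * t + of_int d) / 2 + ((of_int (k * f) + of_int (int p * k * e)) / 2
      - of_int (int p * k * e) * w - of_int (int p * k * e) ^ 2 * t / 2)) * theta w t"
    by (simp only: 1 ecis_add) (simp only: mult_ac)
  also have "of_int c * w ^ 2 * (of_int c * t + of_int d) / 2 + ((of_int (k * f) + of_int (int p * k * e)) / 2
      - of_int (int p * k * e) * w - of_int (int p * k * e) ^ 2 * t / 2) =
      of_int (k * f + int p * k * e + k ^ 2 * e * (d - 2)) / 2"
    using P by (simp add: cP w_def P_def[symmetric] field_simps power2_eq_square)
  also have "\<dots> = of_int l" unfolding l by simp
  finally show ?thesis using J by (simp add: w_def P_def)
qed

section \<open>The pentagonal number theorem and the quintuple product\<close>

text \<open>Completing the square, with one unit of linear decay set aside, bounds the summand by a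
  constant times exp (- |n|).\<close>

lemma summable_on_gaussian_int:
  fixes \<alpha> \<beta> :: real
  assumes "\<alpha> > 0"
  shows "(\<lambda>n::int. exp (- \<alpha> * of_int n ^ 2 + \<beta> * \<bar>of_int n\<bar>)) summable_on UNIV"
proof -
  have geo: "(\<lambda>n::nat. exp (- real n)) summable_on UNIV"
  proof -
    have "summable (\<lambda>n::nat. exp (-1::real) ^ n)" by (intro summable_geometric) auto
    hence "summable (\<lambda>n::nat. exp (- real n))" by (simp flip: exp_of_nat_mult)
    thus ?thesis by (intro norm_summable_imp_summable_on) auto
  qed
  have "(\<lambda>n::int. exp (- \<bar>of_int n :: real\<bar>)) summable_on (range int \<union> (range (\<lambda>n. - int n - 1)))"
  proof (rule summable_on_Un_disjoint)
    show "(\<lambda>n::int. exp (- \<bar>of_int n :: real\<bar>)) summable_on range int"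
      using geo by (subst summable_on_reindex) (auto simp: o_def)
    have "(\<lambda>n::nat. exp (-1::real) * exp (- real n)) summable_on UNIV"
      by (intro summable_on_cmult_right geo)
    thus "(\<lambda>n::int. exp (- \<bar>of_int n :: real\<bar>)) summable_on range (\<lambda>n. - int n - 1)"
      by (subst summable_on_reindex) (auto simp: o_def inj_on_def abs_if simp flip: exp_add)
  qed auto
  also have "range int \<union> (range (\<lambda>n. - int n - 1)) = UNIV"
  proof -
    have "x \<in> range int \<union> (range (\<lambda>n. - int n - 1))" for x
      by (cases "x \<ge> 0") (auto simp: image_iff intro: exI[of _ "nat x"] exI[of _ "nat (- x - 1)"])
    thus ?thesis by blast
  qed
  finally have "(\<lambda>n::int. exp ((\<beta> + 1) ^ 2 / (4 * \<alpha>)) * exp (- \<bar>of_int n :: real\<bar>)) summable_on UNIV"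
    by (rule summable_on_cmult_right)
  thus ?thesis
  proof (rule summable_on_comparison_test)
    fix n :: int
    define x where "x = \<bar>real_of_int n\<bar>"
    have "0 \<le> (2 * \<alpha> * x - (\<beta> + 1)) ^ 2 / (4 * \<alpha>)" using assms by simp
    also have "\<dots> = \<alpha> * x ^ 2 - (\<beta> + 1) * x + (\<beta> + 1) ^ 2 / (4 * \<alpha>)"
      using assms by (simp add: field_simps power2_eq_square)
    finally have "- \<alpha> * x ^ 2 + \<beta> * x \<le> (\<beta> + 1) ^ 2 / (4 * \<alpha>) - x" by (simp add: algebra_simps)
    moreover have "x ^ 2 = of_int n ^ 2" by (simp add: x_def)
    ultimately have "- \<alpha> * of_int n ^ 2 + \<beta> * \<bar>of_int n\<bar> \<le> (\<beta> + 1) ^ 2 / (4 * \<alpha>) + - \<bar>of_int n\<bar>"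
      by (simp add: x_def)
    thus "exp (- \<alpha> * of_int n ^ 2 + \<beta> * \<bar>of_int n\<bar>) \<le> exp ((\<beta> + 1) ^ 2 / (4 * \<alpha>)) * exp (- \<bar>of_int n :: real\<bar>)"
      by (simp flip: exp_add)
  qed auto
qed

text \<open>The summands \<open>(-1)\<^sup>n q\<^bsup>n(3n+1)/2\<^esup> x\<^bsup>(6n+1)/2\<^esup>\<close> of the quintuple product identity,
  with \<open>q = ecis t\<close>, \<open>x = ecis u\<close>.\<close>
definition pent_term :: "complex \<Rightarrow> complex \<Rightarrow> int \<Rightarrow> complex" where
  "pent_term u t n = ecis (of_int n / 2 + (3 * of_int n ^ 2 + of_int n) / 2 * t + (6 * of_int n + 1) / 2 * u)"

definition pent_series :: "complex \<Rightarrow> complex \<Rightarrow> complex" where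
  "pent_series u t = (\<Sum>\<^sub>\<infinity>n. pent_term u t n)"

lemma norm_pent_term_le:
  assumes "Im t > 0" "\<bar>Im u\<bar> \<le> B"
  shows "norm (pent_term u t n) \<le> exp (pi * B) * exp (- (2 * pi * Im t) * of_int n ^ 2 + 6 * pi * B * \<bar>of_int n\<bar>)"
proof -
  define x where "x = real_of_int n"
  \<comment> \<open>This uses that n is an integer. It gives 3 n^2 + n >= 2 n^2, so the majorant is
    Gaussian with no linear term from t.\<close>
  have "0 \<le> n * (n + 1)" by (cases "n \<ge> 0") (auto intro: mult_nonpos_nonpos)
  hence "0 \<le> x * (x + 1)" unfolding x_def by (metis of_int_0_le_iff of_int_1 of_int_add of_int_mult)
  hence 1: "2 * x ^ 2 * Im t \<le> (3 * x ^ 2 + x) * Im t"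
    using assms by (intro mult_right_mono) (auto simp: power2_eq_square algebra_simps)
  have "\<bar>(6 * x + 1) * Im u\<bar> \<le> (6 * \<bar>x\<bar> + 1) * B"
    unfolding abs_mult using assms by (intro mult_mono) auto
  hence 2: "- ((6 * x + 1) * Im u) \<le> (6 * \<bar>x\<bar> + 1) * B" by linarith
  have "norm (pent_term u t n) = exp (pi * (- ((3 * x ^ 2 + x) * Im t) + - ((6 * x + 1) * Im u)))"
  proof -
    have "of_int n / 2 + (3 * of_int n ^ 2 + of_int n) / 2 * t + (6 * of_int n + 1) / 2 * u =
        of_real (x / 2) + of_real ((3 * x ^ 2 + x) / 2) * t + of_real ((6 * x + 1) / 2) * u"
      by (simp add: x_def)
    also have "Im \<dots> = (3 * x ^ 2 + x) / 2 * Im t + (6 * x + 1) / 2 * Im u" by simp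
    finally have "norm (pent_term u t n) = exp (- 2 * pi * ((3 * x ^ 2 + x) / 2 * Im t + (6 * x + 1) / 2 * Im u))"
      unfolding pent_term_def norm_ecis by (simp only:)
    moreover have "- 2 * pi * (v / 2 * v' + w / 2 * w') = pi * (- (v * v') + - (w * w'))" for v v' w w' :: real
      by (simp add: algebra_simps)
    ultimately show ?thesis by (simp only:)
  qed
  also have "\<dots> \<le> exp (pi * (- (2 * x ^ 2 * Im t) + (6 * \<bar>x\<bar> + 1) * B))"
    using 1 2 by (subst exp_le_cancel_iff) (intro mult_left_mono, linarith, simp)
  also have "\<dots> = exp (pi * B) * exp (- (2 * pi * Im t) * of_int n ^ 2 + 6 * pi * B * \<bar>of_int n\<bar>)"
    by (simp add: x_def algebra_simps flip: exp_add)
  finally show ?thesis .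
qed

lemma summable_on_pent_bound:
  "Im t > 0 \<Longrightarrow> (\<lambda>n::int. exp (pi * B) * exp (- (2 * pi * Im t) * of_int n ^ 2 + 6 * pi * B * \<bar>of_int n\<bar>)) summable_on UNIV"
  by (intro summable_on_cmult_right summable_on_gaussian_int) auto

lemma has_sum_pent_series:
  assumes "Im t > 0"
  shows "((\<lambda>n. pent_term u t n) has_sum pent_series u t) UNIV"
  unfolding pent_series_def
proof (rule has_sum_infsum, rule abs_summable_summable)
  show "(\<lambda>n. norm (pent_term u t n)) summable_on UNIV"
    by (rule summable_on_comparison_test[OF summable_on_pent_bound norm_pent_term_le]) (use assms in auto)
qed

lemma holomorphic_pent_series:
  assumes t: "Im t > 0"
  shows "(\<lambda>u. pent_series u t) holomorphic_on UNIV"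
proof -
  have "(\<lambda>u. pent_series u t) holomorphic_on ball z 1" for z
  proof (rule holomorphic_uniform_limit)
    show "uniform_limit (cball z 1) (\<lambda>A u. \<Sum>n\<in>A. pent_term u t n) (\<lambda>u. pent_series u t) (finite_subsets_at_top UNIV)"
      unfolding pent_series_def
    proof (rule Weierstrass_m_test_general[OF norm_pent_term_le[OF t] summable_on_pent_bound[OF t]])
      fix u assume "u \<in> cball z 1"
      hence "norm (u - z) \<le> 1" by (simp add: dist_norm norm_minus_commute)
      thus "\<bar>Im u\<bar> \<le> \<bar>Im z\<bar> + 1" using abs_Im_le_cmod[of "u - z"] by simp
    qed
    show "\<forall>\<^sub>F A in finite_subsets_at_top UNIV. continuous_on (cball z 1) (\<lambda>u. \<Sum>n\<in>A. pent_term u t n) \<and>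
        (\<lambda>u. \<Sum>n\<in>A. pent_term u t n) holomorphic_on ball z 1"
      unfolding pent_term_def
      by (intro always_eventually allI conjI holomorphic_on_imp_continuous_on holomorphic_intros)
  qed auto
  hence "(\<lambda>u. pent_series u t) analytic_on {z}" for z
    by (meson analytic_at centre_in_ball open_ball zero_less_one)
  thus ?thesis using analytic_imp_holomorphic analytic_on_analytic_at by blast
qed

lemma pent_series_plus_1:
  assumes "Im t > 0"
  shows "pent_series (u + 1) t = ecis (3 / 2) * pent_series u t"
proof -
  have "pent_term (u + 1) t n = ecis (3 / 2) * pent_term u t n" for n
    unfolding pent_term_def ecis_add[symmetric]
    by (rule ecis_eqI[of _ _ "3 * n - 1"]) (simp add: field_simps)
  thus ?thesis unfolding pent_series_def infsum_cmult_right'[symmetric] by (intro infsum_cong)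
qed

lemma pent_series_plus_tau:
  assumes "Im t > 0"
  shows "pent_series (u + t) t = ecis (3 * (1 / 2 - u - t / 2)) * pent_series u t"
proof -
  have "pent_term (u + t) t n = ecis (3 * (1 / 2 - u - t / 2)) * pent_term u t (n + 1)" for n
    unfolding pent_term_def ecis_add[symmetric]
    by (rule ecis_eqI[of _ _ "-2"]) (simp add: field_simps power2_eq_square)
  hence "pent_series (u + t) t = ecis (3 * (1 / 2 - u - t / 2)) * (\<Sum>\<^sub>\<infinity>n. pent_term u t (n + 1))"
    unfolding pent_series_def infsum_cmult_right'[symmetric] by (intro infsum_cong)
  also have "(\<Sum>\<^sub>\<infinity>n. pent_term u t (n + 1)) = pent_series u t"
    unfolding pent_series_def
    by (rule infsum_reindex_bij_witness[of _ "\<lambda>n. n - 1" "\<lambda>n. n + 1"]) auto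
  finally show ?thesis .
qed

text \<open>Shanks' finite form of Euler's theorem, with \<open>tri s\<close> = s (s + 1) / 2.
  Passing from n to n + 1, the differences \<open>D\<close> telescope with primitive
  \<open>- V\<close>; the boundary term \<open>- V n\<close> supplies one new pentagonal term and
  the summand s = n + 1 the other. The right side is the symmetric partial sum of the pentagonal
  series.\<close>

lemma shanks_pentagonal_identity:
  fixes q :: complex
  defines "tri \<equiv> (\<lambda>s. \<Sum>{..s::nat})"
  defines "PR \<equiv> (\<lambda>s n. \<Prod>k\<in>{s..<n}. 1 - q ^ Suc k)"
  shows "(\<Sum>s\<le>n. (-1) ^ s * PR s n * q ^ (s * n + tri s)) =
         1 + (\<Sum>s<n. (-1) ^ Suc s * (q ^ (Suc s ^ 2 + tri s) + q ^ (Suc s ^ 2 + tri (Suc s))))"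
proof (induction n)
  case 0
  show ?case by (simp add: PR_def tri_def)
next
  case (Suc n)
  define V where "V = (\<lambda>s. (-1) ^ s * PR s n * q ^ (Suc s * Suc n + tri s))"
  define D where "D = (\<lambda>s. (-1) ^ s * PR s (Suc n) * q ^ (s * Suc n + tri s) - (-1) ^ s * PR s n * q ^ (s * n + tri s))"
  have tri: "tri (Suc s) = tri s + Suc s" for s by (simp add: tri_def)
  have PR1: "PR s (Suc n) = PR s n * (1 - q ^ Suc n)" if "s \<le> n" for s
    using that by (simp add: PR_def)
  have PR2: "PR s n = (1 - q ^ Suc s) * PR (Suc s) n" if "s < n" for s
    using that by (simp add: PR_def prod.atLeast_Suc_lessThan)
  have "j \<le> n \<Longrightarrow> (\<Sum>s\<le>j. D s) = - V j" for j
  proof (induction j)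
    case 0
    show ?case by (simp add: D_def V_def PR1 tri_def algebra_simps)
  next
    case (Suc j)
    have "q ^ (Suc j * n + tri (Suc j)) = q ^ (Suc j * Suc n + tri j)"
      by (simp add: tri algebra_simps)
    moreover have "q ^ (Suc j * Suc n + tri (Suc j)) = q ^ Suc j * q ^ (Suc j * Suc n + tri j)"
      by (simp only: tri power_add mult_ac)
    moreover have "q ^ (Suc (Suc j) * Suc n + tri (Suc j)) = q ^ Suc n * (q ^ Suc j * q ^ (Suc j * Suc n + tri j))"
    proof -
      have "Suc (Suc j) * Suc n + tri (Suc j) = Suc n + (Suc j + (Suc j * Suc n + tri j))" by (simp add: tri)
      thus ?thesis by (simp only: power_add)
    qed
    moreover have "PR (Suc j) (Suc n) = PR (Suc j) n * (1 - q ^ Suc n)" using Suc by (intro PR1) auto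
    moreover have "PR j n = (1 - q ^ Suc j) * PR (Suc j) n" using Suc by (intro PR2) auto
    ultimately have "D (Suc j) = V j - V (Suc j)"
      unfolding D_def V_def by (simp only: power_Suc[of "-1"]) (simp add: algebra_simps del: power_Suc mult_Suc)
    thus ?case using Suc by simp
  qed
  from this[of n] have "(\<Sum>s\<le>n. (-1) ^ s * PR s (Suc n) * q ^ (s * Suc n + tri s)) =
      (\<Sum>s\<le>n. (-1) ^ s * PR s n * q ^ (s * n + tri s)) - V n"
    by (simp add: D_def sum_subtractf algebra_simps)
  moreover have "V n = (-1) ^ n * q ^ (Suc n ^ 2 + tri n)"
    by (simp add: V_def PR_def power2_eq_square)
  moreover have "PR (Suc n) (Suc n) = 1" by (simp add: PR_def)
  ultimately show ?case using Suc.IH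
    by (simp add: power2_eq_square algebra_simps)
qed

lemma pent_term_0:
  assumes "2 * int e = 3 * k ^ 2 + k"
  shows "pent_term 0 t k = (-1) ^ nat \<bar>k\<bar> * ecis t ^ e"
proof -
  have "(3 * of_int k ^ 2 + of_int k) / 2 = (of_nat e :: complex)"
    using arg_cong[OF assms, of "of_int :: int \<Rightarrow> complex"] by (simp add: mult.commute)
  moreover have "ecis (of_int k / 2) = (-1) ^ nat \<bar>k\<bar>"
  proof -
    have "ecis (of_int k / 2) = ecis (of_nat (nat \<bar>k\<bar>) / 2)"
    proof (cases "k \<ge> 0")
      case False
      thus ?thesis by (intro ecis_eqI[of _ _ k]) simp
    qed auto
    also have "\<dots> = (-1) ^ nat \<bar>k\<bar>" using ecis_power[of "1 / 2" "nat \<bar>k\<bar>"] by simp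
    finally show ?thesis .
  qed
  ultimately show ?thesis by (simp add: pent_term_def ecis_add ecis_power)
qed

lemma pentagonal_number_theorem:
  assumes t: "Im t > 0"
  shows "pent_series 0 t = qpoch (ecis t) (ecis t)"
proof -
  define q where "q = ecis t"
  define r where "r = norm q"
  have q: "norm q < 1" using norm_ecis_less_1[OF t] by (simp add: q_def)
  have r: "0 \<le> r" "r < 1" using q by (auto simp: r_def)
  define tri where "tri = (\<lambda>s. \<Sum>{..s::nat})"
  define PR where "PR = (\<lambda>s n. \<Prod>k\<in>{s..<n}. 1 - q ^ Suc k)"
  define F where "F = (\<lambda>n. \<Sum>s\<le>n. (-1) ^ s * PR s n * q ^ (s * n + tri s))"
  have tri2: "2 * int (tri s) = int s * (int s + 1)" for s
    by (induction s) (auto simp: tri_def algebra_simps)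
  have partial: "(\<Sum>k\<in>{- int n..int n}. pent_term 0 t k) = F n" for n
  proof -
    have "(\<Sum>k\<in>{- int n..int n}. pent_term 0 t k) =
      1 + (\<Sum>s<n. (-1) ^ Suc s * (q ^ (Suc s ^ 2 + tri s) + q ^ (Suc s ^ 2 + tri (Suc s))))"
    proof (induction n)
      case 0
      show ?case by (simp add: pent_term_def)
    next
      case (Suc n)
      have "{- int (Suc n)..int (Suc n)} = insert (int (Suc n)) (insert (- int (Suc n)) {- int n..int n})"
        by auto
      hence "(\<Sum>k\<in>{- int (Suc n)..int (Suc n)}. pent_term 0 t k) =
         pent_term 0 t (int (Suc n)) + pent_term 0 t (- int (Suc n)) + (\<Sum>k\<in>{- int n..int n}. pent_term 0 t k)"
        by simp
      moreover have "pent_term 0 t (int (Suc n)) = (-1) ^ Suc n * q ^ (Suc n ^ 2 + tri (Suc n))"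
      proof -
        define N where "N = int (Suc n)"
        have "2 * int (tri (Suc n)) = N * (N + 1)" unfolding N_def by (rule tri2)
        hence "2 * int (Suc n ^ 2 + tri (Suc n)) = 3 * N ^ 2 + N"
          unfolding of_nat_add of_nat_power N_def[symmetric] by (simp add: power2_eq_square distrib_left)
        from pent_term_0[OF this, of t] show ?thesis
          by (simp only: N_def q_def abs_of_nat nat_int)
      qed
      moreover have "pent_term 0 t (- int (Suc n)) = (-1) ^ Suc n * q ^ (Suc n ^ 2 + tri n)"
      proof -
        define N where "N = int (Suc n)"
        have "2 * int (tri n) = (N - 1) * N" using tri2[of n] by (simp add: N_def mult.commute)
        hence "2 * int (Suc n ^ 2 + tri n) = 3 * (- N) ^ 2 + (- N)"
          unfolding of_nat_add of_nat_power N_def[symmetric] by (simp add: power2_eq_square algebra_simps)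
        from pent_term_0[OF this, of t] show ?thesis
          by (simp only: N_def q_def abs_minus_cancel abs_of_nat nat_int)
      qed
      ultimately show ?case by (simp only: Suc.IH sum.lessThan_Suc distrib_left add_ac)
    qed
    also have "\<dots> = F n"
      unfolding F_def PR_def tri_def by (rule shanks_pentagonal_identity[symmetric])
    finally show ?thesis .
  qed
  have "filterlim (\<lambda>n. {- int n..int n}) (finite_subsets_at_top UNIV) sequentially"
    unfolding filterlim_finite_subsets_at_top
  proof (intro allI impI)
    fix X :: "int set" assume X: "finite X \<and> X \<subseteq> UNIV"
    define m where "m = Max (abs ` X)"
    have m: "\<bar>x\<bar> \<le> m" if "x \<in> X" for x
      unfolding m_def using X that by (intro Max_ge) auto
    have "X \<subseteq> {- int n..int n}" if "n \<ge> nat m" for n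
    proof
      fix x assume "x \<in> X"
      from m[OF this] that show "x \<in> {- int n..int n}" by auto
    qed
    thus "\<forall>\<^sub>F n in sequentially. finite {- int n..int n} \<and> X \<subseteq> {- int n..int n} \<and> {- int n..int n} \<subseteq> UNIV"
      by (intro eventually_sequentiallyI[of "nat m"]) auto
  qed
  with has_sum_pent_series[OF t, of 0] have "(\<lambda>n. \<Sum>k\<in>{- int n..int n}. pent_term 0 t k) \<longlonglongrightarrow> pent_series 0 t"
    unfolding has_sum_def by (rule filterlim_compose)
  hence "F \<longlonglongrightarrow> pent_series 0 t" by (simp add: partial)
  moreover have "F \<longlonglongrightarrow> qpoch q q"
  proof -
    define C where "C = exp (1 / (1 - r))"
    have PR_le: "norm (PR s n) \<le> C" for s n
    proof -
      have "norm (PR s n) \<le> (\<Prod>k\<in>{s..<n}. 1 + r * r ^ k)"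
        unfolding PR_def prod_norm[symmetric]
      proof (intro prod_mono conjI)
        fix k show "norm (1 - q ^ Suc k) \<le> 1 + r * r ^ k"
          using norm_triangle_ineq4[of 1 "q ^ Suc k"] by (simp add: norm_mult norm_power r_def)
      qed auto
      also have "\<dots> \<le> (\<Prod>k<n. 1 + r * r ^ k)"
        using r by (intro prod_mono2) auto
      also have "\<dots> \<le> C" unfolding C_def by (rule prod_le_exp_inverse[OF r])
      finally show ?thesis .
    qed
    \<comment> \<open>Every summand with s >= 1 contains q^(s n), so only s = 0 survives in the
      limit, and that summand is the partial product.\<close>
    have bound: "norm (F n - PR 0 n) \<le> C * (real n * r ^ n)" for n
    proof -
      have "F n - PR 0 n = (\<Sum>s\<in>{..n}-{0}. (-1) ^ s * PR s n * q ^ (s * n + tri s))"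
        unfolding F_def by (subst sum.remove[of _ 0]) (auto simp: tri_def)
      also have "norm \<dots> \<le> (\<Sum>s\<in>{..n}-{0}. C * r ^ n)"
      proof (rule sum_norm_le)
        fix s assume s: "s \<in> {..n} - {0}"
        hence "1 * n \<le> s * n" by (intro mult_le_mono1) auto
        hence "n \<le> s * n + tri s" by linarith
        hence "r ^ (s * n + tri s) \<le> r ^ n" using r by (intro power_decreasing) auto
        thus "norm ((-1) ^ s * PR s n * q ^ (s * n + tri s)) \<le> C * r ^ n"
          using PR_le[of s n] r unfolding norm_mult norm_power r_def[symmetric]
          by (intro mult_mono) (auto simp: C_def)
      qed
      also have "\<dots> = C * (real n * r ^ n)" by simp
      finally show ?thesis .
    qed
    have "(\<lambda>n. C * (real n * r ^ n)) \<longlonglongrightarrow> C * 0"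
      using powser_times_n_limit_0[of r] r by (intro tendsto_mult_left) auto
    hence "(\<lambda>n. C * (real n * r ^ n)) \<longlonglongrightarrow> 0" by simp
    hence "(\<lambda>n. F n - PR 0 n) \<longlonglongrightarrow> 0"
      by (rule Lim_null_comparison[OF always_eventually[OF allI[OF bound]]])
    moreover have "(\<lambda>n. PR 0 n) \<longlonglongrightarrow> qpoch q q"
      using qpoch_LIMSEQ[OF q, of q] by (simp add: PR_def atLeast0LessThan)
    ultimately have "(\<lambda>n. (F n - PR 0 n) + PR 0 n) \<longlonglongrightarrow> 0 + qpoch q q" by (rule tendsto_add)
    thus ?thesis by simp
  qed
  ultimately show ?thesis unfolding q_def by (rule LIMSEQ_unique)
qed

text \<open>The sum side of the quintuple product identity. Symmetrising in u creates the evenness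
  that forces the zeros at half-periods.\<close>

definition quint :: "complex \<Rightarrow> complex \<Rightarrow> complex" where
  "quint u t = pent_series u t + pent_series (- u) t"

lemma quint_uminus: "quint (- u) t = quint u t"
  by (simp add: quint_def)

context
  fixes t :: complex
  assumes t: "Im t > 0"
begin

lemma pent_series_lattice:
  "pent_series (u + of_int a + of_int b * t) t =
     ecis (3 * ((of_int a + of_int b) / 2 - of_int b * u - of_int b ^ 2 * t / 2) - 3 * of_int a * of_int b)
       * pent_series u t"
  by (rule quasi_periodic_lattice[of "\<lambda>u. pent_series u t"])
     (auto simp: pent_series_plus_1[OF t] pent_series_plus_tau[OF t])

lemma quint_plus_1: "quint (u + 1) t = ecis (3 / 2) * quint u t"
proof -
  have "pent_series (- u + of_int (-1) + of_int 0 * t) t = ecis (- (3 / 2)) * pent_series (- u) t"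
    by (subst pent_series_lattice) simp
  moreover have "ecis (- (3 / 2)) = ecis (3 / 2)" by (rule ecis_eqI[of _ _ "-3"]) simp
  ultimately have "pent_series (- (u + 1)) t = ecis (3 / 2) * pent_series (- u) t" by simp
  thus ?thesis by (simp add: quint_def pent_series_plus_1[OF t] distrib_left)
qed

lemma quint_plus_tau: "quint (u + t) t = ecis (3 * (1 / 2 - u - t / 2)) * quint u t"
proof -
  have "pent_series (- u + of_int 0 + of_int (-1) * t) t = ecis (- (3 / 2) - 3 * u - 3 * t / 2) * pent_series (- u) t"
    by (subst pent_series_lattice) (simp add: algebra_simps)
  moreover have "ecis (- (3 / 2) - 3 * u - 3 * t / 2) = ecis (3 * (1 / 2 - u - t / 2))"
    by (rule ecis_eqI[of _ _ "-3"]) (simp add: algebra_simps)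
  ultimately have "pent_series (- (u + t)) t = ecis (3 * (1 / 2 - u - t / 2)) * pent_series (- u) t" by simp
  thus ?thesis by (simp only: quint_def pent_series_plus_tau[OF t] distrib_left)
qed

lemma quint_lattice:
  "quint (u + of_int a + of_int b * t) t =
     ecis (3 * ((of_int a + of_int b) / 2 - of_int b * u - of_int b ^ 2 * t / 2) - 3 * of_int a * of_int b) * quint u t"
  by (rule quasi_periodic_lattice[of "\<lambda>u. quint u t"]) (rule quint_plus_1 quint_plus_tau)+

lemma holomorphic_quint: "(\<lambda>u. quint u t) holomorphic_on UNIV"
proof -
  have "((\<lambda>u. pent_series u t) \<circ> uminus) holomorphic_on UNIV"
    by (rule holomorphic_on_compose_gen[OF _ holomorphic_pent_series[OF t]]) (auto intro!: holomorphic_intros)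
  thus ?thesis unfolding quint_def
    by (intro holomorphic_intros holomorphic_pent_series[OF t]) (simp add: o_def)
qed

text \<open>An even theta function of odd index vanishes at the nontrivial half-periods.\<close>
lemma quint_half_lattice_eq_0:
  assumes u: "2 * u = of_int a + of_int b * t" and ab: "odd a \<or> odd b"
  shows "quint u t = 0"
proof -
  have "odd (3 * (a + b - a * b))" using ab by auto
  then obtain l where l: "3 * (a + b - a * b) = 2 * l + 1" by (elim oddE)
  have "u = - u + of_int a + of_int b * t" using u by (simp add: algebra_simps)
  hence "quint u t = quint (- u + of_int a + of_int b * t) t"
    by (rule arg_cong[where f = "\<lambda>u. quint u t"])
  also have "\<dots> = ecis (3 * ((of_int a + of_int b) / 2 - of_int b * (- u) - of_int b ^ 2 * t / 2) - 3 * of_int a * of_int b)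
      * quint u t"
    by (simp only: quint_lattice quint_uminus)
  also have "3 * ((of_int a + of_int b) / 2 - of_int b * (- u) - of_int b ^ 2 * t / 2) - 3 * of_int a * of_int b =
      (of_int (3 * (a + b - a * b)) + 3 * of_int b * (2 * u - of_int a - of_int b * t)) / 2"
    by (simp add: field_simps power2_eq_square)
  also have "\<dots> = (of_int (2 * l + 1) + 3 * of_int b * (2 * u - of_int a - of_int b * t)) / 2" by (simp only: l)
  also have "\<dots> = 1 / 2 + of_int l" by (simp add: u add_divide_distrib)
  also have "ecis \<dots> = -1" by (simp only: ecis_add ecis_half ecis_of_int mult_1_right)
  finally show ?thesis by simp
qed

text \<open>The zeros of theta (2 u) are the half-lattice points. At lattice points
  \<open>theta u t\<close> vanishes, at the remaining ones \<open>quint u t\<close> does, so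
  uniqueness of theta functions applies; the constant comes from the derivative at 0 and the
  pentagonal number theorem.\<close>

lemma quintuple_product:
  "quint u t * theta u t = qpoch (ecis t) (ecis t) * theta (2 * u) t"
proof -
  define N where "N = (\<lambda>u. quint u t * theta u t)"
  define D where "D = (\<lambda>u. theta (2 * u) t)"
  have hol: "N holomorphic_on UNIV" "D holomorphic_on UNIV"
  proof -
    show "N holomorphic_on UNIV" unfolding N_def
      by (intro holomorphic_intros holomorphic_quint holomorphic_theta t)
    have "((\<lambda>u. theta u t) \<circ> (\<lambda>u. 2 * u)) holomorphic_on UNIV"
      by (rule holomorphic_on_compose_gen[OF _ holomorphic_theta[OF t]]) (auto intro!: holomorphic_intros)
    thus "D holomorphic_on UNIV" by (simp add: D_def o_def)
  qed
  have derivD: "(D has_field_derivative 2 * deriv (\<lambda>u. theta u t) (2 * u)) (at u)" for u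
  proof -
    have "((\<lambda>u. theta u t) has_field_derivative deriv (\<lambda>u. theta u t) (2 * u)) (at (2 * u))"
      by (rule holomorphic_derivI[OF holomorphic_theta[OF t]]) auto
    moreover have "((\<lambda>u. 2 * u) has_field_derivative 2) (at u)" by (auto intro!: derivative_eq_intros)
    ultimately show ?thesis unfolding D_def by (rule DERIV_chain2[THEN DERIV_cong]) simp
  qed
  have "\<exists>k. \<forall>u. N u = k * D u"
  proof (rule theta_function_unique[OF hol t, where ?m1.0 = "\<lambda>_. 1" and ?m2.0 = "\<lambda>u. ecis (- 4 * u - 2 * t)"])
    show "N (u + 1) = 1 * N u" for u
    proof -
      have "ecis (3 / 2) = ecis (1 / 2)" by (rule ecis_eqI[of _ _ 1]) simp
      thus ?thesis by (simp add: N_def quint_plus_1 theta_plus_1[OF t])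
    qed
    show "D (u + 1) = 1 * D u" for u
    proof -
      have "D (u + 1) = theta (2 * u + of_int 2 + of_int 0 * t) t" by (simp add: D_def algebra_simps)
      also have "\<dots> = ecis (of_int 1) * theta (2 * u) t" by (simp only: theta_lattice[OF t]) simp
      finally show ?thesis by (simp add: D_def)
    qed
    show "N (u + t) = ecis (- 4 * u - 2 * t) * N u" for u
    proof -
      have "N (u + t) = ecis (3 * (1 / 2 - u - t / 2) + (1 / 2 - u - t / 2)) * N u"
        by (simp only: N_def quint_plus_tau theta_plus_tau[OF t] ecis_add) (simp only: mult_ac)
      also have "ecis (3 * (1 / 2 - u - t / 2) + (1 / 2 - u - t / 2)) = ecis (- 4 * u - 2 * t)"
        by (rule ecis_eqI[of _ _ 2]) (simp add: field_simps)
      finally show ?thesis .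
    qed
    show "D (u + t) = ecis (- 4 * u - 2 * t) * D u" for u
    proof -
      have "D (u + t) = theta (2 * u + of_int 0 + of_int 2 * t) t" by (simp add: D_def algebra_simps)
      also have "\<dots> = ecis ((of_int 0 + of_int 2) / 2 - of_int 2 * (2 * u) - of_int 2 ^ 2 * t / 2) * D u"
        by (simp only: theta_lattice[OF t] D_def)
      also have "ecis ((of_int 0 + of_int 2) / 2 - of_int 2 * (2 * u) - of_int 2 ^ 2 * t / 2) = ecis (- 4 * u - 2 * t)"
        by (rule ecis_eqI[of _ _ 1]) simp
      finally show ?thesis .
    qed
    show "N u = 0 \<and> deriv D u \<noteq> 0" if zero: "D u = 0" for u
    proof
      obtain a b :: int where ab: "2 * u = of_int a + of_int b * t"
        using zero theta_eq_0_iff[OF t] by (auto simp: D_def)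
      show "N u = 0"
      proof (cases "odd a \<or> odd b")
        case True
        thus ?thesis using quint_half_lattice_eq_0[OF ab] by (simp add: N_def)
      next
        case False
        then obtain x y where "a = 2 * x" "b = 2 * y" by (auto elim!: evenE)
        hence "2 * u = 2 * (of_int x + of_int y * t)" using ab by (simp add: algebra_simps)
        hence "u = of_int x + of_int y * t" by (simp only: mult_cancel_left) simp
        hence "theta u t = 0" using theta_eq_0_iff[OF t] by blast
        thus ?thesis by (simp add: N_def)
      qed
      have "deriv (\<lambda>u. theta u t) (2 * u) \<noteq> 0" using zero by (intro deriv_theta_nonzero t) (simp add: D_def)
      thus "deriv D u \<noteq> 0" using DERIV_imp_deriv[OF derivD[of u]] by simp
    qed
  qed auto
  then obtain k where k: "\<And>u. N u = k * D u" by blast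
  have "k = qpoch (ecis t) (ecis t)"
  proof -
    have "((\<lambda>u. quint u t) has_field_derivative deriv (\<lambda>u. quint u t) 0) (at 0)"
      by (rule holomorphic_derivI[OF holomorphic_quint]) auto
    from DERIV_mult[OF this has_field_derivative_theta_0[OF t]]
    have "(N has_field_derivative quint 0 t * (2 * pi * \<i>)) (at 0)"
      by (simp add: N_def theta_0[OF t] mult_ac)
    moreover have "(N has_field_derivative k * (2 * (2 * pi * \<i>))) (at 0)"
      unfolding k using DERIV_cmult[OF derivD[of 0], of k] DERIV_imp_deriv[OF has_field_derivative_theta_0[OF t]] by simp
    ultimately have "quint 0 t * (2 * pi * \<i>) = k * (2 * (2 * pi * \<i>))" by (rule DERIV_unique)
    hence "quint 0 t = 2 * k" by simp
    thus ?thesis using pentagonal_number_theorem[OF t] by (simp add: quint_def)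
  qed
  with k[of u] show ?thesis by (simp add: N_def D_def)
qed

end

section \<open>Sieving the unary theta series modulo p\<close>

lemma has_sum_finite_sum:
  fixes f :: "'i \<Rightarrow> 'a \<Rightarrow> complex"
  assumes "\<And>j. j \<in> J \<Longrightarrow> (f j has_sum S j) A"
  shows "((\<lambda>n. \<Sum>j\<in>J. f j n) has_sum (\<Sum>j\<in>J. S j)) A"
  using assms by (induction J rule: infinite_finite_induct) (auto intro!: has_sum_add)

lemma sum_roots_of_unity:
  fixes p :: nat and m :: int
  assumes "p > 0"
  shows "(\<Sum>j<p. ecis (of_int m * of_nat j / of_nat p)) = (if int p dvd m then of_nat p else 0)"
proof -
  define w where "w = ecis (of_int m / of_nat p)"
  have w: "ecis (of_int m * of_nat j / of_nat p) = w ^ j" for j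
    by (simp add: w_def ecis_power mult_ac)
  have w1: "w = 1 \<longleftrightarrow> int p dvd m"
  proof
    assume "w = 1"
    then obtain n :: int where "of_int m / of_nat p = (of_int n :: complex)"
      by (auto simp: w_def ecis_eq_1_iff)
    hence "of_int m = (of_int (n * int p) :: complex)" using assms by (simp add: field_simps)
    thus "int p dvd m" by (simp only: of_int_eq_iff) simp
  next
    assume "int p dvd m"
    then obtain n where "m = int p * n" ..
    thus "w = 1" using assms by (simp add: w_def)
  qed
  have "w ^ p = 1" using assms by (simp add: w_def ecis_power)
  hence "w \<noteq> 1 \<Longrightarrow> (\<Sum>j<p. w ^ j) = 0" by (simp add: geometric_sum)
  thus ?thesis unfolding w using w1 by (cases "w = 1") auto
qed

text \<open>Exhibits \<open>s_p p\<close> as a generalised pentagonal number and shows that its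
  \<open>div\<close> by 24 is exact. The number 6 e + 1 is p or -p, whichever is 1 modulo 6, so e is
  negative when p is 5 modulo 6.\<close>

lemma six_times_plus_one:
  fixes p :: nat
  assumes "prime p" "p > 3"
  obtains e :: int where "\<bar>6 * e + 1\<bar> = int p" "2 * s_p p = 3 * e ^ 2 + e"
proof -
  have "\<not> 2 dvd p" "\<not> 3 dvd p"
    using assms by (auto simp: prime_nat_iff)
  hence "int p mod 6 = 1 \<or> int p mod 6 = 5" by presburger
  then obtain e where e: "\<bar>6 * e + 1\<bar> = int p"
  proof
    assume "int p mod 6 = 1"
    thus ?thesis by (intro that[of "int p div 6"]) presburger
  next
    assume "int p mod 6 = 5"
    thus ?thesis by (intro that[of "- (int p div 6) - 1"]) presburger
  qed
  have "even (3 * e ^ 2 + e)" by simp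
  then obtain h where h: "3 * e ^ 2 + e = 2 * h" ..
  have "int p ^ 2 = (6 * e + 1) ^ 2" unfolding e[symmetric] by simp
  also have "\<dots> = 12 * (3 * e ^ 2 + e) + 1" by (simp add: power2_eq_square algebra_simps)
  finally have "s_p p = h" by (simp add: s_p_def h)
  with e h that show ?thesis by simp
qed

lemma s_p_nonneg: "prime p \<Longrightarrow> s_p p \<ge> 0"
  using prime_gt_0_nat[of p] by (simp add: s_p_def pos_imp_zdiv_nonneg_iff one_le_power)

text \<open>Summing over j keeps only the n with p dividing 6 n + 1. The points 2 j / p rather than
  j / p clear the half-integral frequency (6 n + 1) / 2, and the sign \<open>\<delta>\<close> serves
  the two halves of \<open>quint\<close>.\<close>

lemma sum_pent_series_torsion:
  fixes p :: nat and e \<delta> :: int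
  assumes t: "Im t > 0" and e: "\<bar>6 * e + 1\<bar> = int p" "2 * s_p p = 3 * e ^ 2 + e" and \<delta>: "\<bar>\<delta>\<bar> = 1"
  shows "(\<Sum>j<p. pent_series (of_int \<delta> * (2 * of_nat j / of_nat p)) t) =
     of_nat p * ecis (of_int e / 2) * ecis (of_int (s_p p) * t) *
       qpoch (ecis (of_nat p ^ 2 * t)) (ecis (of_nat p ^ 2 * t))"
proof -
  define r where "r = 6 * e + 1"
  have "6 * e + 1 \<noteq> 0" by presburger
  hence p0: "p > 0" using e(1) by (auto intro: Nat.gr0I)
  have r: "\<bar>r\<bar> = int p" using e by (simp add: r_def)
  have r2: "of_nat p ^ 2 = (of_int r ^ 2 :: complex)"
  proof -
    have "int p ^ 2 = r ^ 2" unfolding r[symmetric] by simp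
    thus ?thesis by (metis of_int_of_nat_eq of_int_power)
  qed
  have tp: "Im (of_nat p ^ 2 * t) > 0"
    using t p0 by (simp flip: of_nat_power)
  have sumj: "(\<Sum>j<p. pent_term (of_int \<delta> * (2 * of_nat j / of_nat p)) t n) =
      (if r dvd 6 * n + 1 then of_nat p * pent_term 0 t n else 0)" for n
  proof -
    have "pent_term (of_int \<delta> * (2 * of_nat j / of_nat p)) t n =
        pent_term 0 t n * ecis (of_int (\<delta> * (6 * n + 1)) * of_nat j / of_nat p)" for j
      unfolding pent_term_def ecis_add[symmetric] by (rule arg_cong[where f = ecis]) simp
    hence "(\<Sum>j<p. pent_term (of_int \<delta> * (2 * of_nat j / of_nat p)) t n) =
        pent_term 0 t n * (\<Sum>j<p. ecis (of_int (\<delta> * (6 * n + 1)) * of_nat j / of_nat p))"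
      by (simp only: sum_distrib_left)
    also have "\<dots> = pent_term 0 t n * (if int p dvd \<delta> * (6 * n + 1) then of_nat p else 0)"
      by (simp only: sum_roots_of_unity[OF p0])
    also have "int p dvd \<delta> * (6 * n + 1) \<longleftrightarrow> r dvd 6 * n + 1"
      using \<delta> r by (metis abs_dvd_iff abs_mult dvd_abs_iff mult_1)
    finally show ?thesis by simp
  qed
  define B where "B = {n. r dvd 6 * n + 1}"
  have bij: "bij_betw (\<lambda>k. r * k + e) UNIV B"
  proof (rule bij_betwI')
    fix k l :: int
    have "r \<noteq> 0" using r p0 by auto
    thus "(r * k + e = r * l + e) = (k = l)" by simp
  next
    fix k :: int
    have "6 * (r * k + e) + 1 = r * (6 * k + 1)" by (simp add: r_def algebra_simps)
    thus "r * k + e \<in> B" by (simp add: B_def)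
  next
    fix n assume "n \<in> B"
    then obtain l where l: "6 * n + 1 = r * l" by (auto simp: B_def)
    \<comment> \<open>Since r is 1 modulo 6, so is the cofactor l.\<close>
    hence "l - 1 = 6 * (n - e * l)" by (simp add: r_def algebra_simps)
    then obtain k where "l = 6 * k + 1" by (metis add.commute diff_add_cancel)
    with l have "n = r * k + e" by (simp add: r_def algebra_simps)
    thus "\<exists>k\<in>UNIV. n = r * k + e" by blast
  qed
  \<comment> \<open>Completing the square separates the exponents. The signs agree because r - 1 = 6
    e turns the discrepancy (r - 1) k / 2 into the integer 3 e k.\<close>
  have pterm: "pent_term 0 t (r * k + e) = ecis (of_int e / 2) * ecis (of_int (s_p p) * t) * pent_term 0 (of_nat p ^ 2 * t) k" for k
  proof -
    have "of_int (s_p p) = (3 * of_int e ^ 2 + of_int e) / (2 :: complex)"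
      using arg_cong[OF e(2), of "of_int :: int \<Rightarrow> complex"] by (simp add: field_simps)
    thus ?thesis
      unfolding pent_term_def ecis_add[symmetric] r2
      by (intro ecis_eqI[of _ _ "3 * e * k"]) (simp add: r_def field_simps power2_eq_square)
  qed
  have "((\<lambda>n. \<Sum>j<p. pent_term (of_int \<delta> * (2 * of_nat j / of_nat p)) t n) has_sum
      (\<Sum>j<p. pent_series (of_int \<delta> * (2 * of_nat j / of_nat p)) t)) UNIV"
    by (intro has_sum_finite_sum has_sum_pent_series t)
  hence "((\<lambda>n. if r dvd 6 * n + 1 then of_nat p * pent_term 0 t n else 0) has_sum
      (\<Sum>j<p. pent_series (of_int \<delta> * (2 * of_nat j / of_nat p)) t)) UNIV"
    by (simp only: sumj)
  also have "?this \<longleftrightarrow> ((\<lambda>n. of_nat p * pent_term 0 t n) has_sum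
      (\<Sum>j<p. pent_series (of_int \<delta> * (2 * of_nat j / of_nat p)) t)) B"
    by (rule has_sum_cong_neutral) (auto simp: B_def)
  also have "\<dots> \<longleftrightarrow> ((\<lambda>k. of_nat p * pent_term 0 t (r * k + e)) has_sum
      (\<Sum>j<p. pent_series (of_int \<delta> * (2 * of_nat j / of_nat p)) t)) UNIV"
    by (rule has_sum_reindex_bij_betw[OF bij, symmetric])
  finally have 1: "((\<lambda>k. of_nat p * pent_term 0 t (r * k + e)) has_sum
      (\<Sum>j<p. pent_series (of_int \<delta> * (2 * of_nat j / of_nat p)) t)) UNIV" .
  have 2: "((\<lambda>k. of_nat p * pent_term 0 t (r * k + e)) has_sum
      of_nat p * (ecis (of_int e / 2) * ecis (of_int (s_p p) * t) * pent_series 0 (of_nat p ^ 2 * t))) UNIV"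
    unfolding pterm by (intro has_sum_cmult_right has_sum_pent_series tp)
  show ?thesis
    using has_sum_unique[OF 1 2] by (simp only: pentagonal_number_theorem[OF tp] mult.assoc)
qed

section \<open>The eta quotient and the crank generating function\<close>

text \<open>The fractional powers q^(p^2/24) and q^(-1/24) of the two eta functions combine to the
  integral exponent \<open>s_p p\<close>.\<close>

definition eta_quotient :: "nat \<Rightarrow> complex \<Rightarrow> complex" where
  "eta_quotient p t = ecis (of_int (s_p p) * t) * qpoch (ecis (of_nat p ^ 2 * t)) (ecis (of_nat p ^ 2 * t)) /
     qpoch (ecis t) (ecis t)"

lemma theta_torsion_nonzero:
  fixes p j :: nat
  assumes "Im t > 0" "p > 0" "\<not> p dvd j"
  shows "theta (of_nat j / of_nat p) t \<noteq> 0"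
proof
  assume "theta (of_nat j / of_nat p) t = 0"
  then obtain a b :: int where ab: "of_nat j / of_nat p = of_int a + of_int b * t"
    using theta_eq_0_iff[OF assms(1)] by auto
  have "Im (of_nat j / of_nat p) = 0"
    by (metis Im_complex_of_real of_real_divide of_real_of_nat_eq)
  hence "of_int b * Im t = 0" by (simp add: ab)
  hence "b = 0" using assms(1) by simp
  hence "of_nat j = (of_int (a * int p) :: complex)" using ab assms(2) by (simp add: field_simps)
  hence "int j = a * int p" by (metis of_int_eq_iff of_int_of_nat_eq)
  hence "int p dvd int j" by simp
  thus False using assms(3) by (simp only: int_dvd_int_iff)
qed

text \<open>Isolating the exponents divisible by \<open>p\<close> in the quintuple product identity turns
  \<open>\<eta>(p\<^sup>2 t) / \<eta>(t)\<close> into a sum of quotients of theta values at \<open>p\<close>-torsion points.\<close>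
lemma eta_quotient_eq_sum_theta:
  assumes p: "prime p" "p > 3"
  obtains c :: complex where "c \<noteq> 0" "\<And>t. Im t > 0 \<Longrightarrow>
    c * eta_quotient p t = 2 + (\<Sum>j=1..<p. theta (of_int (4 * int j) / of_nat p) t / theta (of_int (2 * int j) / of_nat p) t)"
proof -
  obtain e :: int where e: "\<bar>6 * e + 1\<bar> = int p" "2 * s_p p = 3 * e ^ 2 + e"
    using six_times_plus_one[OF p] by blast
  show ?thesis
  proof
    show "2 * of_nat p * ecis (of_int e / 2) \<noteq> 0" using p by (auto simp: prime_gt_0_nat)
    fix t :: complex assume t: "Im t > 0"
    define E where "E = qpoch (ecis t) (ecis t)"
    have E: "E \<noteq> 0" using qpoch_ecis_nonzero[OF t] by (simp add: E_def)
    \<comment> \<open>The term j = 0 is split off since theta vanishes there in numerator and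
      denominator; it is the source of the constant 2 in the statement.\<close>
    have quint0: "quint 0 t = 2 * E"
      using pentagonal_number_theorem[OF t] by (simp add: quint_def E_def)
    have quintj: "quint (2 * of_nat j / of_nat p) t =
        E * (theta (of_int (4 * int j) / of_nat p) t / theta (of_int (2 * int j) / of_nat p) t)" if "j \<in> {1..<p}" for j
    proof -
      have "\<not> p dvd 2 * j"
      proof
        assume "p dvd 2 * j"
        hence "p dvd 2 \<or> p dvd j" using p by (simp add: prime_dvd_mult_iff)
        thus False using p that by (auto dest!: dvd_imp_le)
      qed
      hence "theta (2 * of_nat j / of_nat p) t \<noteq> 0"
        using theta_torsion_nonzero[OF t, of p "2 * j"] p by simp
      thus ?thesis using quintuple_product[OF t, of "2 * of_nat j / of_nat p"]
        by (simp add: E_def field_simps)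
    qed
    have "2 * of_nat p * ecis (of_int e / 2) * eta_quotient p t * E =
      (\<Sum>j<p. pent_series (of_int 1 * (2 * of_nat j / of_nat p)) t) +
      (\<Sum>j<p. pent_series (of_int (-1) * (2 * of_nat j / of_nat p)) t)"
      by (subst (1 2) sum_pent_series_torsion[OF t e]) (use E in \<open>auto simp: eta_quotient_def E_def[symmetric]\<close>)
    also have "\<dots> = (\<Sum>j<p. quint (2 * of_nat j / of_nat p) t)"
      by (simp add: quint_def sum.distrib)
    also have "{..<p} = insert 0 {1..<p}" using p by auto
    also have "(\<Sum>j\<in>insert 0 {1..<p}. quint (2 * of_nat j / of_nat p) t) =
       2 * E + (\<Sum>j=1..<p. quint (2 * of_nat j / of_nat p) t)" by (simp add: quint0)
    also have "(\<Sum>j=1..<p. quint (2 * of_nat j / of_nat p) t) =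
      E * (\<Sum>j=1..<p. theta (of_int (4 * int j) / of_nat p) t / theta (of_int (2 * int j) / of_nat p) t)"
      unfolding sum_distrib_left by (intro sum.cong refl quintj)
    finally have "2 * of_nat p * ecis (of_int e / 2) * eta_quotient p t * E =
      (2 + (\<Sum>j=1..<p. theta (of_int (4 * int j) / of_nat p) t / theta (of_int (2 * int j) / of_nat p) t)) * E"
      by (simp only: distrib_right) (simp only: mult_ac)
    thus "2 * of_nat p * ecis (of_int e / 2) * eta_quotient p t =
      2 + (\<Sum>j=1..<p. theta (of_int (4 * int j) / of_nat p) t / theta (of_int (2 * int j) / of_nat p) t)"
      using E by (simp only: mult_cancel_right) simp
  qed
qed

text \<open>All torsion values of theta acquire the same factor 1 / J, so their quotients are
  invariant, and the constant relating them to the eta quotient does not depend on t.\<close>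

lemma eta_quotient_modular:
  fixes a b c d :: int
  assumes p: "prime p" "p > 3" and det: "a * d - b * c = 1" and t: "Im t > 0"
    and c: "int p ^ 2 dvd c" and d: "d mod int p = 1 mod int p"
  shows "eta_quotient p ((of_int a * t + of_int b) / (of_int c * t + of_int d)) = eta_quotient p t"
proof -
  define J s where "J = of_int c * t + of_int d" and "s = (of_int a * t + of_int b) / J"
  have J: "J \<noteq> 0" using moebius_denominator_nonzero[OF det t] by (simp add: J_def)
  have s: "Im s > 0" using Im_moebius_pos[OF det t] by (simp add: s_def J_def)
  have "odd p" using p by (simp add: prime_odd_nat)
  hence tor: "theta (of_int k / of_nat p) s = inverse J * theta (of_int k / of_nat p) t" for k
    unfolding s_def J_def by (intro theta_torsion_modular det t c d)
  obtain k :: complex where k: "k \<noteq> 0" "\<And>t. Im t > 0 \<Longrightarrow>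
    k * eta_quotient p t = 2 + (\<Sum>j=1..<p. theta (of_int (4 * int j) / of_nat p) t / theta (of_int (2 * int j) / of_nat p) t)"
    using eta_quotient_eq_sum_theta[OF p] by blast
  have "k * eta_quotient p s = k * eta_quotient p t"
    unfolding k(2)[OF s] k(2)[OF t] tor using J by simp
  thus ?thesis using k(1) by (simp add: s_def J_def)
qed

definition crank_gf :: "complex \<Rightarrow> complex \<Rightarrow> complex" where
  "crank_gf x q = qpoch q q / (qpoch (x * q) q * qpoch (inverse x * q) q)"

text \<open>This is \<open>\<eta>(p\<^sup>2 t) q\<^bsup>-1/24\<^esup> C(\<zeta>\<^sub>p, q)\<close>, since \<open>s_p p = (p\<^sup>2 - 1) / 24\<close>.\<close>
definition crank_form :: "nat \<Rightarrow> complex \<Rightarrow> complex" where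
  "crank_form p t = ecis (of_int (s_p p) * t) * qpoch (ecis (of_nat p ^ 2 * t)) (ecis (of_nat p ^ 2 * t)) *
     crank_gf (zeta p) (ecis t)"

lemma zeta_eq: "zeta p = ecis (1 / of_nat p)"
  by (simp add: zeta_def ecis_def)

text \<open>The crank function is a constant divided by E * theta (1 / p) with E =
  \<open>qpoch (ecis t) (ecis t)\<close>, and this 1 / E is the denominator of the eta
  quotient.\<close>

lemma crank_form_eq:
  assumes p: "prime p" "p > 3" and t: "Im t > 0"
  shows "crank_form p t = (ecis (1 / of_nat p / 2) - ecis (- (1 / of_nat p) / 2)) * eta_quotient p t / theta (1 / of_nat p) t"
proof -
  define A B C E M where "A = ecis (1 / of_nat p / 2) - ecis (- (1 / of_nat p) / 2)"
    and "B = qpoch (ecis (t + 1 / of_nat p)) (ecis t)" and "C = qpoch (ecis (t - 1 / of_nat p)) (ecis t)"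
    and "E = qpoch (ecis t) (ecis t)"
    and "M = ecis (of_int (s_p p) * t) * qpoch (ecis (of_nat p ^ 2 * t)) (ecis (of_nat p ^ 2 * t))"
  have "theta (of_nat 1 / of_nat p) t \<noteq> 0"
    using p t by (intro theta_torsion_nonzero) auto
  hence "A * B * C / E ^ 2 \<noteq> 0" by (simp add: theta_def A_def B_def C_def E_def)
  hence nz: "A \<noteq> 0" "B \<noteq> 0" "C \<noteq> 0" "E \<noteq> 0" by auto
  have 1: "crank_form p t = M * (E / (B * C))"
    by (simp add: crank_form_def crank_gf_def M_def E_def B_def C_def zeta_eq ecis_add ecis_diff divide_inverse mult.commute)
  have 2: "eta_quotient p t = M / E" by (simp add: eta_quotient_def M_def E_def)
  have 3: "theta (1 / of_nat p) t = A * B * C / E ^ 2"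
    by (simp only: theta_def A_def B_def C_def E_def)
  show ?thesis
    unfolding A_def[symmetric] 1 2 3 using nz by (simp add: field_simps power2_eq_square)
qed

lemma crank_form_modular:
  fixes a b c d :: int
  assumes p: "prime p" "p > 3" and det: "a * d - b * c = 1" and t: "Im t > 0"
    and c: "int p ^ 2 dvd c" and d: "d mod int p = 1 mod int p"
  shows "crank_form p ((of_int a * t + of_int b) / (of_int c * t + of_int d)) = (of_int c * t + of_int d) * crank_form p t"
proof -
  define J s where "J = of_int c * t + of_int d" and "s = (of_int a * t + of_int b) / J"
  have J: "J \<noteq> 0" using moebius_denominator_nonzero[OF det t] by (simp add: J_def)
  have s: "Im s > 0" using Im_moebius_pos[OF det t] by (simp add: s_def J_def)
  have "odd p" using p by (simp add: prime_odd_nat)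
  hence tor: "theta (of_int 1 / of_nat p) s = inverse J * theta (of_int 1 / of_nat p) t"
    unfolding s_def J_def by (intro theta_torsion_modular det t c d)
  have eta: "eta_quotient p s = eta_quotient p t"
    unfolding s_def J_def by (rule eta_quotient_modular[OF p det t c d])
  show ?thesis
    unfolding J_def[symmetric] s_def[symmetric] crank_form_eq[OF p s] crank_form_eq[OF p t] eta
      tor[unfolded of_int_1]
    by (simp only: divide_inverse inverse_mult_distrib inverse_inverse_eq mult_ac)
qed

section \<open>Taylor coefficients of the crank generating function\<close>

lemma power_series_has_sum:
  assumes "f holomorphic_on ball 0 1" "norm (w :: complex) < 1"
  shows "((\<lambda>n. (deriv ^^ n) f 0 / fact n * w ^ n) has_sum f w) UNIV"
proof -
  have sums: "(\<lambda>n. (deriv ^^ n) f 0 / fact n * v ^ n) sums f v" if "norm v < 1" for v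
    using holomorphic_power_series[OF assms(1), of v] that by simp
  obtain r where r: "norm w < r" "r < 1" using dense assms(2) by blast
  have "norm w < norm (of_real r :: complex)" using r by (smt (verit) norm_ge_zero norm_of_real)
  moreover have "summable (\<lambda>n. (deriv ^^ n) f 0 / fact n * (of_real r :: complex) ^ n)"
    using sums[of "of_real r"] r order_le_less_trans[OF norm_ge_zero r(1)] by (auto intro: sums_summable)
  ultimately have "summable (\<lambda>n. norm ((deriv ^^ n) f 0 / fact n * w ^ n))"
    by (intro powser_insidea)
  thus ?thesis using sums[OF assms(2)] by (rule norm_summable_imp_has_sum)
qed

lemma holomorphic_crank_gf:
  assumes "norm x = 1"
  shows "crank_gf x holomorphic_on ball 0 1"
proof -
  have "qpoch (y * q) q \<noteq> 0" if "q \<in> ball 0 1" "norm y = 1" for q y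
    by (rule qpoch_nonzero) (use that in \<open>auto simp: norm_mult\<close>)
  thus ?thesis unfolding crank_gf_def[abs_def] using assms
    by (intro holomorphic_intros holomorphic_qpoch) (auto simp: norm_inverse)
qed

text \<open>Numerator and denominator of \<open>crank_factor x k\<close> agree modulo X^k, so the
  factor is 1 modulo X^k and leaves lower coefficients alone.\<close>

lemma fps_nth_mult_crank_factor:
  assumes "n < k"
  shows "fps_nth (A * crank_factor x k) n = fps_nth A n"
proof -
  define D where "D = (1 - fps_const x * fps_X ^ k) * (1 - fps_const (inverse x) * fps_X ^ k :: complex fps)"
  have D0: "fps_nth D 0 \<noteq> 0" using assms by (simp add: D_def)
  define H where "H = 1 - fps_X ^ k - D"
  have "1 - Y - (1 - u * Y) * (1 - v * Y) = Y * (u + v - 1 - u * v * Y)" for u v Y :: "complex fps"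
    by (simp add: algebra_simps)
  then obtain R where R: "H = fps_X ^ k * R" unfolding H_def D_def by blast
  have "crank_factor x k = (D + H) * inverse D"
    unfolding crank_factor_def D_def[symmetric] fps_divide_unit[OF D0] by (simp add: H_def)
  also have "\<dots> = 1 + fps_X ^ k * (R * inverse D)"
    using inverse_mult_eq_1'[OF D0] by (simp add: distrib_right R mult.assoc)
  finally have "A * crank_factor x k = A + fps_X ^ k * (A * (R * inverse D))"
    by (simp add: distrib_left mult_ac)
  thus ?thesis using assms by (simp add: fps_X_power_mult_nth)
qed

lemma fps_nth_prod_crank_factor:
  "n \<le> N \<Longrightarrow> fps_nth (\<Prod>k\<in>{1..N}. crank_factor x k) n = crank_coeff_nat x n"
proof (induction N rule: dec_induct)
  case base
  show ?case by (simp add: crank_coeff_nat_def)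
next
  case (step N)
  have "{1..Suc N} = insert (Suc N) {1..N}" by auto
  hence "(\<Prod>k\<in>{1..Suc N}. crank_factor x k) = (\<Prod>k\<in>{1..N}. crank_factor x k) * crank_factor x (Suc N)"
    by (simp add: mult.commute)
  thus ?case using step by (simp add: fps_nth_mult_crank_factor)
qed

definition crank_partial :: "complex \<Rightarrow> nat \<Rightarrow> complex \<Rightarrow> complex" where
  "crank_partial x N q = (\<Prod>k\<in>{1..N}. (1 - q ^ k) / ((1 - x * q ^ k) * (1 - inverse x * q ^ k)))"

lemma crank_partial_has_fps_expansion:
  "crank_partial x N has_fps_expansion (\<Prod>k\<in>{1..N}. crank_factor x k)"
  unfolding crank_partial_def[abs_def] crank_factor_def
  by (intro fps_expansion_intros) (auto simp: fps_X_power_nth)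

lemma crank_partial_eq:
  "crank_partial x N q = (\<Prod>n<N. 1 - q * q ^ n) / ((\<Prod>n<N. 1 - x * q * q ^ n) * (\<Prod>n<N. 1 - inverse x * q * q ^ n))"
proof -
  have "crank_partial x N q = (\<Prod>n<N. (1 - q ^ Suc n) / ((1 - x * q ^ Suc n) * (1 - inverse x * q ^ Suc n)))"
    unfolding crank_partial_def image_Suc_lessThan[symmetric] by (subst prod.reindex) (auto simp: o_def)
  thus ?thesis by (simp only: prod_dividef prod.distrib power_Suc mult.assoc)
qed

text \<open>On this circle norm q = exp (- ln 2), so \<open>norm_qpoch_ge\<close> keeps the limiting
  denominator away from 0, as division of uniform limits requires.\<close>

lemma uniform_limit_crank_partial:
  assumes x: "norm x = 1"
  shows "uniform_limit (sphere 0 (1 / 2)) (crank_partial x) (crank_gf x) sequentially"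
proof -
  define S where "S = sphere (0 :: complex) (1 / 2)"
  have S: "norm q = exp (- ln 2)" "norm q < 1" if "q \<in> S" for q
    using that by (simp_all add: S_def exp_minus)
  have "compact S" by (simp add: S_def)
  have lim: "uniform_limit S (\<lambda>N q. \<Prod>n<N. 1 - y * q * q ^ n) (\<lambda>q. qpoch (y * q) q) sequentially" for y
    by (intro uniform_limit_qpoch continuous_intros \<open>compact S\<close> S(2))
  define L where "L = exp (- (\<Sum>j. 1 / real (Suc j) ^ 2) / ln 2)"
  have upper: "norm (qpoch (y * q) q) \<le> exp 2" if "q \<in> S" "norm y = 1" for q y
  proof -
    have q: "norm q = 1 / 2" using that by (simp add: S_def)
    have "norm (qpoch (y * q) q) \<le> exp (1 / (1 - norm q))"
      by (rule norm_qpoch_le) (use q that(2) in \<open>simp_all add: norm_mult\<close>)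
    also have "1 / (1 - norm q) = 2" unfolding q by simp
    finally show ?thesis .
  qed
  have lower: "norm (qpoch (y * q) q) \<ge> L" if "q \<in> S" "norm y = 1" for q y
    unfolding L_def by (rule norm_qpoch_ge) (use that S in \<open>simp_all add: norm_mult\<close>)
  have bdd: "bounded ((\<lambda>q. qpoch (y * q) q) ` S)" if "norm y = 1" for y
    using upper that by (auto simp: bounded_iff)
  have xi: "norm (inverse x) = 1" using x by (simp add: norm_inverse)
  have "uniform_limit S (\<lambda>N q. (\<Prod>n<N. 1 - 1 * q * q ^ n) / ((\<Prod>n<N. 1 - x * q * q ^ n) * (\<Prod>n<N. 1 - inverse x * q * q ^ n)))
      (\<lambda>q. qpoch (1 * q) q / (qpoch (x * q) q * qpoch (inverse x * q) q)) sequentially"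
  proof (rule uniform_lim_divide[where b = "L * L"])
    show "uniform_limit S (\<lambda>N q. (\<Prod>n<N. 1 - x * q * q ^ n) * (\<Prod>n<N. 1 - inverse x * q * q ^ n))
      (\<lambda>q. qpoch (x * q) q * qpoch (inverse x * q) q) sequentially"
      by (intro uniform_lim_mult lim bdd x xi)
    show "L * L \<le> norm (qpoch (x * q) q * qpoch (inverse x * q) q)" if "q \<in> S" for q
      unfolding norm_mult using that by (intro mult_mono lower x xi) (auto simp: L_def)
    show "L * L > 0" by (simp add: L_def)
    show "bounded ((\<lambda>q. qpoch (1 * q) q) ` S)" by (rule bdd) simp
  qed (rule lim)
  thus ?thesis
    unfolding S_def crank_partial_eq[abs_def] crank_gf_def[abs_def] mult_1_left .
qed

text \<open>Links the formal definition of the crank coefficients to the analytic product: Cauchy's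
  inequality turns uniform convergence of the truncations into convergence of coefficients, and the
  coefficients of the truncations are eventually constant.\<close>

lemma taylor_coeff_crank_gf:
  assumes x: "norm x = 1"
  shows "(deriv ^^ n) (crank_gf x) 0 / fact n = crank_coeff_nat x n"
proof -
  define F where "F = fps_expansion (crank_gf x) 0"
  have F: "crank_gf x has_fps_expansion F"
    unfolding F_def by (rule has_fps_expansion_fps_expansion[OF _ _ holomorphic_crank_gf[OF x]]) auto
  have "norm (fps_nth F n - crank_coeff_nat x n) \<le> \<epsilon>" if \<epsilon>: "\<epsilon> > 0" for \<epsilon>
  proof -
    \<comment> \<open>Cauchy's inequality at radius 1 / 2 costs a factor 2^n, compensated here in
      advance. Taking N >= n below makes the formal coefficient final.\<close>
    define \<delta> where "\<delta> = \<epsilon> * (1 / 2) ^ n"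
    have "\<delta> > 0" using \<epsilon> by (simp add: \<delta>_def)
    from uniform_limitD[OF uniform_limit_crank_partial[OF x] this]
    obtain N0 where N0: "\<And>N q. N \<ge> N0 \<Longrightarrow> q \<in> sphere 0 (1/2) \<Longrightarrow> dist (crank_partial x N q) (crank_gf x q) < \<delta>"
      unfolding eventually_sequentially by blast
    define N where "N = max N0 n"
    define D where "D = (\<lambda>q. crank_gf x q - crank_partial x N q)"
    have "D has_fps_expansion F - (\<Prod>k\<in>{1..N}. crank_factor x k)"
      unfolding D_def by (intro has_fps_expansion_diff F crank_partial_has_fps_expansion)
    moreover have "fps_nth (\<Prod>k\<in>{1..N}. crank_factor x k) n = crank_coeff_nat x n"
      by (rule fps_nth_prod_crank_factor) (simp add: N_def)
    ultimately have 1: "fps_nth F n - crank_coeff_nat x n = (deriv ^^ n) D 0 / fact n"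
      using fps_nth_fps_expansion by (metis fps_sub_nth)
    have "D holomorphic_on ball 0 1"
    proof -
      have "1 - y * q ^ k \<noteq> 0" if "q \<in> ball 0 1" "k \<in> {1..N}" "norm y = 1" for q y :: complex and k
      proof
        assume "1 - y * q ^ k = 0"
        hence "norm (y * q ^ k) = norm (1::complex)" by simp
        hence "norm q ^ k = 1" using that by (simp add: norm_mult norm_power)
        moreover have "norm q ^ k < 1" using that by (auto simp: power_less_one_iff)
        ultimately show False by simp
      qed
      thus ?thesis unfolding D_def crank_partial_def using x
        by (intro holomorphic_intros holomorphic_crank_gf x) (auto simp: norm_inverse)
    qed
    hence "D holomorphic_on ball 0 (1/2)" "continuous_on (cball 0 (1/2)) D"
      by (auto intro: holomorphic_on_subset continuous_on_subset[OF holomorphic_on_imp_continuous_on])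
    hence "norm ((deriv ^^ n) D 0) \<le> fact n * \<delta> / (1/2) ^ n"
    proof (rule Cauchy_inequality)
      fix q :: complex assume "norm (0 - q) = 1 / 2"
      hence "dist (crank_partial x N q) (crank_gf x q) < \<delta>" by (intro N0) (auto simp: N_def)
      thus "norm (D q) \<le> \<delta>" by (simp add: D_def dist_norm norm_minus_commute)
    qed auto
    hence "norm ((deriv ^^ n) D 0 / fact n) \<le> \<epsilon>" by (simp add: \<delta>_def norm_divide field_simps)
    thus ?thesis by (simp add: 1)
  qed
  hence "norm (fps_nth F n - crank_coeff_nat x n) \<le> 0" by (rule field_le_epsilon[of _ 0, simplified])
  thus ?thesis using fps_nth_fps_expansion[OF F, of n] by simp
qed

lemma norm_zeta [simp]: "norm (zeta p) = 1"
  by (simp add: zeta_eq norm_ecis Im_divide)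

lemma crank_gf_has_sum:
  assumes "norm q < 1"
  shows "((\<lambda>n. crank_c p (int n) * q ^ n) has_sum crank_gf (zeta p) q) UNIV"
  using power_series_has_sum[OF holomorphic_crank_gf[OF norm_zeta] assms]
  by (simp add: taylor_coeff_crank_gf crank_c_def)

text \<open>Because \<open>crank_c\<close> vanishes at negative arguments, the shifted series may be
  summed over all integers, where residue classes modulo p can be selected.\<close>

lemma crank_gf_has_sum_int:
  assumes z: "Im z > 0" and p: "p > 0"
  shows "((\<lambda>l::int. crank_c p (l - s) * ecis (of_int l * z / of_nat p)) has_sum
           ecis (of_int s * z / of_nat p) * crank_gf (zeta p) (ecis (z / of_nat p))) UNIV"
proof -
  have "norm (ecis (z / of_nat p)) < 1"
    using z p by (intro norm_ecis_less_1) (simp add: Im_divide_of_nat)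
  from crank_gf_has_sum[OF this, of p]
  have "((\<lambda>n. ecis (of_int s * z / of_nat p) * (crank_c p (int n) * ecis (z / of_nat p) ^ n)) has_sum
      ecis (of_int s * z / of_nat p) * crank_gf (zeta p) (ecis (z / of_nat p))) UNIV"
    by (rule has_sum_cmult_right)
  also have "(\<lambda>n. ecis (of_int s * z / of_nat p) * (crank_c p (int n) * ecis (z / of_nat p) ^ n)) =
     (\<lambda>n. crank_c p (int n + s - s) * ecis (of_int (int n + s) * z / of_nat p))"
    by (auto simp: fun_eq_iff ecis_power ecis_add add_divide_distrib distrib_right)
  also have "(\<dots> has_sum ecis (of_int s * z / of_nat p) * crank_gf (zeta p) (ecis (z / of_nat p))) UNIV \<longleftrightarrow>
     ((\<lambda>l. crank_c p (l - s) * ecis (of_int l * z / of_nat p)) has_sum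
        ecis (of_int s * z / of_nat p) * crank_gf (zeta p) (ecis (z / of_nat p))) {s..}"
    by (rule has_sum_reindex_bij_witness[of _ "\<lambda>l. nat (l - s)" "\<lambda>n. int n + s"]) auto
  also have "\<dots> \<longleftrightarrow> ((\<lambda>l. crank_c p (l - s) * ecis (of_int l * z / of_nat p)) has_sum
        ecis (of_int s * z / of_nat p) * crank_gf (zeta p) (ecis (z / of_nat p))) UNIV"
    by (rule has_sum_cong_neutral) (auto simp: crank_c_def)
  finally show ?thesis .
qed

lemma K_crank_eq_average:
  assumes z: "Im z > 0" and p: "p > 0"
  shows "K_crank p m z = (\<Sum>k<p. ecis (- (of_nat m * of_nat k / of_nat p)) * crank_form p ((z + of_nat k) / of_nat p)) / of_nat p"
proof -
  define s W where "s = s_p p" and "W = qpoch (ecis (of_nat p * z)) (ecis (of_nat p * z))"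
  define P where "P = (of_nat p :: complex)"
  have P: "P \<noteq> 0" using p by (simp add: P_def)
  define c where "c = (\<lambda>l. crank_c p (l - s) * ecis (of_int l * z / P))"
  have form: "crank_form p ((z + of_nat k) / P) = W * (ecis (of_int s * (z + of_nat k) / P) * crank_gf (zeta p) (ecis ((z + of_nat k) / P)))" for k
  proof -
    \<comment> \<open>The numbers p^2 (z + k) / p and p z differ by the integer p k, so the product
      in q^(p^2) has the same value \<open>W\<close> at all p points and factors out of the
      average.\<close>
    have "ecis (P ^ 2 * ((z + of_nat k) / P)) = ecis (P * z)"
      using P by (intro ecis_eqI[of _ _ "int p * int k"]) (simp add: P_def field_simps power2_eq_square)
    thus ?thesis by (simp add: crank_form_def W_def P_def s_def mult_ac)
  qed
  have base: "((\<lambda>l. crank_c p (l - s) * ecis (of_int l * (z + of_nat k) / P)) has_sum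
      ecis (of_int s * (z + of_nat k) / P) * crank_gf (zeta p) (ecis ((z + of_nat k) / P))) UNIV" for k
    unfolding P_def by (rule crank_gf_has_sum_int) (use z p in auto)
  have "((\<lambda>l. ecis (- (of_nat m * of_nat k / P)) * (W * (crank_c p (l - s) * ecis (of_int l * (z + of_nat k) / P)))) has_sum
      ecis (- (of_nat m * of_nat k / P)) * crank_form p ((z + of_nat k) / P)) UNIV" for k
    unfolding form by (intro has_sum_cmult_right base)
  hence "((\<lambda>l. \<Sum>k<p. ecis (- (of_nat m * of_nat k / P)) * (W * (crank_c p (l - s) * ecis (of_int l * (z + of_nat k) / P)))) has_sum
      (\<Sum>k<p. ecis (- (of_nat m * of_nat k / P)) * crank_form p ((z + of_nat k) / P))) UNIV"
    by (rule has_sum_finite_sum)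
  also have "(\<lambda>l. \<Sum>k<p. ecis (- (of_nat m * of_nat k / P)) * (W * (crank_c p (l - s) * ecis (of_int l * (z + of_nat k) / P)))) =
      (\<lambda>l. if int p dvd l - int m then W * P * c l else 0)"
  proof
    fix l
    have "ecis (- (of_nat m * of_nat k / P)) * (W * (crank_c p (l - s) * ecis (of_int l * (z + of_nat k) / P))) =
        W * c l * ecis (of_int (l - int m) * of_nat k / of_nat p)" for k
    proof -
      have "ecis (- (of_nat m * of_nat k / P)) * ecis (of_int l * (z + of_nat k) / P) =
          ecis (of_int l * z / P) * ecis (of_int (l - int m) * of_nat k / of_nat p)"
        unfolding ecis_add[symmetric] using P by (intro arg_cong[where f = ecis]) (simp add: P_def[symmetric] field_simps)
      thus ?thesis by (simp add: c_def mult_ac)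
    qed
    hence "(\<Sum>k<p. ecis (- (of_nat m * of_nat k / P)) * (W * (crank_c p (l - s) * ecis (of_int l * (z + of_nat k) / P)))) =
        W * c l * (\<Sum>k<p. ecis (of_int (l - int m) * of_nat k / of_nat p))"
      by (simp only: sum_distrib_left)
    also have "\<dots> = (if int p dvd l - int m then W * P * c l else 0)"
      unfolding sum_roots_of_unity[OF p] P_def by simp
    finally show "(\<Sum>k<p. ecis (- (of_nat m * of_nat k / P)) * (W * (crank_c p (l - s) * ecis (of_int l * (z + of_nat k) / P)))) =
        (if int p dvd l - int m then W * P * c l else 0)" .
  qed
  also have "(\<dots> has_sum (\<Sum>k<p. ecis (- (of_nat m * of_nat k / P)) * crank_form p ((z + of_nat k) / P))) UNIV \<longleftrightarrow>
     ((\<lambda>l. W * P * c l) has_sum (\<Sum>k<p. ecis (- (of_nat m * of_nat k / P)) * crank_form p ((z + of_nat k) / P))) {l. int p dvd l - int m}"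
    by (rule has_sum_cong_neutral) auto
  also have "\<dots> \<longleftrightarrow> ((\<lambda>n. W * P * c (int p * n + int m)) has_sum (\<Sum>k<p. ecis (- (of_nat m * of_nat k / P)) * crank_form p ((z + of_nat k) / P))) UNIV"
    by (rule has_sum_reindex_bij_witness[of _ "\<lambda>n. int p * n + int m" "\<lambda>l. (l - int m) div int p"]) (use p in auto)
  also have "(\<lambda>n. W * P * c (int p * n + int m)) =
      (\<lambda>n. W * P * ecis (of_nat m / P * z) * (crank_c p (int p * n + int m - s) * ecis (of_int n * z)))"
  proof
    fix n
    have "ecis (of_int (int p * n + int m) * z / P) = ecis (of_nat m / P * z) * ecis (of_int n * z)"
      unfolding ecis_add[symmetric] using P by (intro arg_cong[where f = ecis]) (simp add: P_def[symmetric] field_simps)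
    thus "W * P * c (int p * n + int m) =
      W * P * ecis (of_nat m / P * z) * (crank_c p (int p * n + int m - s) * ecis (of_int n * z))"
      by (simp only: c_def mult_ac)
  qed
  finally have sum: "((\<lambda>n. W * P * ecis (of_nat m / P * z) * (crank_c p (int p * n + int m - s) * ecis (of_int n * z))) has_sum
      (\<Sum>k<p. ecis (- (of_nat m * of_nat k / P)) * crank_form p ((z + of_nat k) / P))) UNIV" .
  have W: "W = (\<Prod>n. 1 - exp (2 * pi * \<i> * z) ^ (p * Suc n))"
    unfolding W_def qpoch_def
  proof (rule prodinf_cong)
    fix n
    have "exp (2 * pi * \<i> * z) ^ (p * Suc n) = (ecis z ^ p) ^ Suc n"
      by (simp only: ecis_def power_mult)
    also have "\<dots> = ecis (of_nat p * z) * ecis (of_nat p * z) ^ n" by (simp add: ecis_power)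
    finally show "1 - ecis (of_nat p * z) * ecis (of_nat p * z) ^ n = 1 - exp (2 * pi * \<i> * z) ^ (p * Suc n)" by simp
  qed
  have "(\<Sum>k<p. ecis (- (of_nat m * of_nat k / P)) * crank_form p ((z + of_nat k) / P)) =
      (\<Sum>\<^sub>\<infinity>n. W * P * ecis (of_nat m / P * z) * (crank_c p (int p * n + int m - s) * ecis (of_int n * z)))"
    using infsumI[OF sum] by simp
  also have "\<dots> = W * P * ecis (of_nat m / P * z) * (\<Sum>\<^sub>\<infinity>n. crank_c p (int p * n + int m - s) * ecis (of_int n * z))"
    by (rule infsum_cmult_right')
  also have "\<dots> = P * K_crank p m z"
    unfolding K_crank_def W[symmetric] by (simp add: ecis_def P_def s_def mult_ac)
  finally show ?thesis using P by (simp add: P_def)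
qed

section \<open>Expansions at the cusps and modularity\<close>

lemma ecis_periodic_eq:
  assumes "h \<noteq> 0" "ecis (x / h) = ecis (y / h)"
  obtains k :: int where "x = y + of_int k * h"
proof -
  have "ecis (x / h - y / h) = 1" using assms by (simp add: ecis_diff)
  then obtain k :: int where "x / h - y / h = of_int k" by (auto simp: ecis_eq_1_iff)
  hence "x = y + of_int k * h" using assms by (simp add: field_simps)
  thus ?thesis by (rule that)
qed

text \<open>In the coordinate \<open>w = ecis (z / h)\<close> a periodic function of at most exponential growth in
  \<open>Im z\<close> has at worst a pole at \<open>w = 0\<close>.\<close>
lemma meromorphic_at_infinity_of_growth:
  fixes f :: "complex \<Rightarrow> complex" and h :: nat and C M :: real
  assumes hol: "f holomorphic_on upper_half_plane" and h: "h > 0"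
    and per: "\<And>z. Im z > 0 \<Longrightarrow> f (z + of_nat h) = f z"
    and growth: "\<And>z. Im z \<ge> 1 \<Longrightarrow> \<bar>Re z\<bar> \<le> real h \<Longrightarrow> norm (f z) \<le> C * exp (M * Im z)"
  shows "meromorphic_at_infinity f"
proof -
  \<comment> \<open>The order of pole allowed at w = 0: multiplication by w^N, with N >= |M| h,
    outweighs exp (M Im z), even with the factor 2 pi to spare.\<close>
  define N where "N = nat \<lceil>\<bar>M\<bar> * real h\<rceil>"
  define H where "H = (of_real (real h) :: complex)"
  have H: "H \<noteq> 0" using h by (simp add: H_def)
  \<comment> \<open>Extension by 0 makes G periodic on the whole plane, so integer shifts need no
    side condition.\<close>
  define G where "G = (\<lambda>z. if Im z > 0 then f z * ecis (of_nat N * z / H) else 0)"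
  have holG: "G holomorphic_on upper_half_plane"
  proof -
    have "(\<lambda>z. f z * ecis (of_nat N * z / H)) holomorphic_on upper_half_plane"
      using H by (intro holomorphic_intros hol) auto
    thus ?thesis by (rule holomorphic_transform) (auto simp: G_def upper_half_plane_def)
  qed
  have "G (z + H) = G z" for z
  proof -
    have "ecis (of_nat N * (z + H) / H) = ecis (of_nat N * z / H)"
      using H by (intro ecis_eqI[of _ _ "int N"]) (simp add: field_simps)
    thus ?thesis using per[of z] by (simp add: G_def H_def)
  qed
  hence perG: "G (z + of_int k * H) = G z" for z k by (rule periodic_int_shift)
  have G_eqI: "G x = G y" if eq: "ecis (x / H) = ecis (y / H)" for x y
  proof -
    obtain k :: int where "x = y + of_int k * H"
      using ecis_periodic_eq[OF H eq] .
    thus ?thesis by (simp add: perG)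
  qed
  have boundG: "norm (G z) \<le> \<bar>C\<bar>" if "Im z \<ge> 1" "\<bar>Re z\<bar> \<le> real h" for z
  proof -
    have "M * real h \<le> real N"
    proof -
      have "M * real h \<le> \<bar>M\<bar> * real h" by (intro mult_right_mono) auto
      also have "\<dots> \<le> real N" unfolding N_def by linarith
      finally show ?thesis .
    qed
    hence "M \<le> real N / real h" using h by (simp add: field_simps)
    also have "\<dots> = 1 * (real N / real h)" by simp
    also have "\<dots> \<le> 2 * pi * (real N / real h)"
      using pi_gt3 by (intro mult_right_mono) auto
    finally have "M * Im z \<le> 2 * pi * (real N / real h) * Im z" using that by (intro mult_right_mono) auto
    moreover have "norm (ecis (of_nat N * z / H)) = exp (- (2 * pi * (real N / real h) * Im z))"
      unfolding norm_ecis H_def Im_divide_of_real by simp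
    ultimately have "norm (ecis (of_nat N * z / H)) \<le> exp (- (M * Im z))" by simp
    hence "norm (f z) * norm (ecis (of_nat N * z / H)) \<le> (C * exp (M * Im z)) * exp (- (M * Im z))"
      using growth[OF that] by (intro mult_mono) (auto intro: order_trans[OF norm_ge_zero])
    also have "\<dots> = C" by (simp add: exp_minus)
    finally show ?thesis using that by (simp add: G_def norm_mult)
  qed
  \<comment> \<open>A branch of the inverse of z -> ecis (z / h). By \<open>G_eqI\<close> the
    composite F does not depend on the branch, though V jumps across the negative axis.\<close>
  define V where "V = (\<lambda>w. H * Ln w / (2 * pi * \<i>))"
  have V: "ecis (V w / H) = w" if "w \<noteq> 0" for w
    using that H by (simp add: V_def ecis_def)
  have ImV: "Im (V w) = - (real h * ln (norm w) / (2 * pi))" and ReV: "Re (V w) = real h * Im (Ln w) / (2 * pi)"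
    if "w \<noteq> 0" for w
    using that by (simp_all add: V_def H_def Re_Ln Im_divide Re_divide power2_eq_square)
  define F where "F = (\<lambda>w. G (V w))"
  have F_ecis: "F (ecis (z / H)) = G z" for z
    unfolding F_def by (rule G_eqI) (simp add: V)
  have pos: "Im (V w) > 0" if "w \<noteq> 0" "norm w < 1" for w
    using that h by (simp add: ImV mult_less_0_iff divide_less_0_iff)
  have "F holomorphic_on (ball 0 1 - {0})"
  proof -
    define A1 A2 where "A1 = ball 0 1 - (\<real>\<^sub>\<le>\<^sub>0 :: complex set)" and "A2 = ball 0 1 - (\<real>\<^sub>\<ge>\<^sub>0 :: complex set)"
    have "V holomorphic_on A1" unfolding V_def A1_def by (intro holomorphic_intros) auto
    moreover have "V ` A1 \<subseteq> upper_half_plane"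
    proof (rule image_subsetI)
      fix w assume "w \<in> A1"
      hence "w \<noteq> 0" "norm w < 1" by (auto simp: A1_def)
      thus "V w \<in> upper_half_plane" using pos by (simp add: upper_half_plane_def)
    qed
    ultimately have 1: "F holomorphic_on A1"
      unfolding F_def using holomorphic_on_compose_gen[OF _ holG] by (auto simp: o_def)
    \<comment> \<open>A second branch, holomorphic across the negative axis: rotating w to -w
      amounts to half a period. The two slit discs cover the punctured disc.\<close>
    define V2 where "V2 = (\<lambda>w. V (- w) + H / 2)"
    have "V2 holomorphic_on A2" unfolding V2_def V_def A2_def
      by (intro holomorphic_intros) (auto simp: complex_nonpos_Reals_iff complex_nonneg_Reals_iff)
    moreover have "V2 ` A2 \<subseteq> upper_half_plane"
    proof (rule image_subsetI)
      fix w assume "w \<in> A2"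
      hence "- w \<noteq> 0" "norm (- w) < 1" by (auto simp: A2_def)
      hence "Im (V (- w)) > 0" by (rule pos)
      thus "V2 w \<in> upper_half_plane" by (simp add: upper_half_plane_def V2_def H_def)
    qed
    ultimately have "(\<lambda>w. G (V2 w)) holomorphic_on A2"
      using holomorphic_on_compose_gen[OF _ holG] by (auto simp: o_def)
    moreover have "G (V2 w) = F w" if "w \<in> A2" for w
    proof -
      have "w \<noteq> 0" using that by (auto simp: A2_def)
      have "V2 w / H = V (- w) / H + 1 / 2" using H by (simp add: V2_def add_divide_distrib)
      hence "ecis (V2 w / H) = w" using V[of "- w"] \<open>w \<noteq> 0\<close> by (simp add: ecis_add)
      thus ?thesis unfolding F_def by (intro G_eqI) (simp add: V \<open>w \<noteq> 0\<close>)
    qed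
    ultimately have 2: "F holomorphic_on A2" by (rule holomorphic_transform)
    have "open A1" "open A2" unfolding A1_def A2_def
      by (intro open_Diff open_ball closed_nonpos_Reals_complex closed_nonneg_Reals_complex)+
    hence "F holomorphic_on (A1 \<union> A2)" using 1 2 by (simp add: holomorphic_on_Un)
    moreover have "ball 0 1 - {0} = A1 \<union> A2"
      by (auto simp: A1_def A2_def complex_nonpos_Reals_iff complex_nonneg_Reals_iff complex_eq_iff)
    ultimately show ?thesis by simp
  qed
  \<comment> \<open>The radius exp (- 2 pi / h) corresponds to Im z = 1, and the principal logarithm
    keeps |Re z| <= h / 2, inside the region of the growth hypothesis.\<close>
  moreover have "eventually (\<lambda>w. norm (F w) \<le> \<bar>C\<bar>) (at 0)"
    unfolding eventually_at
  proof (intro exI[of _ "exp (- (2 * pi / real h))"] conjI ballI impI)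
    fix w :: complex assume w: "w \<noteq> 0 \<and> dist w 0 < exp (- (2 * pi / real h))"
    hence "ln (norm w) < - (2 * pi / real h)" by (metis dist_0_norm dist_commute exp_gt_zero ln_exp ln_less_cancel_iff zero_less_norm_iff)
    hence "Im (V w) \<ge> 1" using w h by (simp add: ImV field_simps)
    moreover have "\<bar>Re (V w)\<bar> \<le> real h"
    proof -
      have "\<bar>Im (Ln w)\<bar> \<le> pi" using w mpi_less_Im_Ln[of w] Im_Ln_le_pi[of w] by auto
      hence "real h * \<bar>Im (Ln w)\<bar> \<le> real h * (2 * pi)" using pi_gt_zero by (intro mult_left_mono) linarith+
      thus ?thesis using w by (simp add: ReV abs_mult field_simps)
    qed
    ultimately show "norm (F w) \<le> \<bar>C\<bar>" unfolding F_def by (rule boundG)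
  qed auto
  ultimately obtain g where g: "g holomorphic_on ball 0 1" "\<And>w. w \<in> ball 0 1 - {0} \<Longrightarrow> g w = F w"
    using holomorphic_on_extend_bounded[of F "ball 0 1" 0] by auto
  define a where "a = (\<lambda>n. (deriv ^^ n) g 0 / fact n)"
  have "((\<lambda>l. a (nat (l + int N)) * exp (2 * pi * \<i> * of_int l * z / of_nat h)) has_sum f z) {- int N..}"
    if z: "z \<in> upper_half_plane" for z
  proof -
    have Imz: "Im z > 0" using z by (simp add: upper_half_plane_def)
    have w: "norm (ecis (z / H)) < 1"
      using Imz h by (intro norm_ecis_less_1) (simp add: H_def Im_divide_of_nat)
    have "g (ecis (z / H)) = f z * ecis (of_nat N * z / H)"
      using g(2)[of "ecis (z / H)"] w Imz by (simp add: F_ecis G_def)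
    hence "((\<lambda>n. a n * ecis (z / H) ^ n) has_sum (f z * ecis (of_nat N * z / H))) UNIV"
      using power_series_has_sum[OF g(1) w] by (simp add: a_def)
    hence "((\<lambda>n. a n * ecis (z / H) ^ n * ecis (- (of_nat N * z / H))) has_sum
        (f z * ecis (of_nat N * z / H) * ecis (- (of_nat N * z / H)))) UNIV"
      by (rule has_sum_cmult_left)
    also have "f z * ecis (of_nat N * z / H) * ecis (- (of_nat N * z / H)) = f z"
      by (simp add: ecis_minus)
    also have "((\<lambda>n. a n * ecis (z / H) ^ n * ecis (- (of_nat N * z / H))) has_sum f z) UNIV \<longleftrightarrow>
      ((\<lambda>l. a (nat (l + int N)) * exp (2 * pi * \<i> * of_int l * z / of_nat h)) has_sum f z) {- int N..}"
    proof (rule has_sum_reindex_bij_witness[of _ "\<lambda>l. nat (l + int N)" "\<lambda>n. int n - int N"])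
      fix n :: nat
      have "ecis (z / H) ^ n * ecis (- (of_nat N * z / H)) = ecis (of_int (int n - int N) * z / H)"
        unfolding ecis_power ecis_add[symmetric] by (rule arg_cong[where f = ecis]) (simp add: H_def diff_divide_distrib left_diff_distrib)
      also have "\<dots> = exp (2 * pi * \<i> * of_int (int n - int N) * z / of_nat h)"
        by (simp add: ecis_def H_def mult_ac)
      finally show "a (nat (int n - int N + int N)) * exp (2 * pi * \<i> * of_int (int n - int N) * z / of_nat h) =
          a n * ecis (z / H) ^ n * ecis (- (of_nat N * z / H))"
        by (simp add: mult.assoc)
    qed auto
    finally show ?thesis .
  qed
  thus ?thesis unfolding meromorphic_at_infinity_def using h
    by (intro exI[of _ h] conjI exI[of _ "- int N"] exI[of _ "\<lambda>l. a (nat (l + int N))"]) auto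
qed

lemma inverse_one_minus_exp_le:
  fixes x :: real
  assumes "x > 0"
  shows "1 / (1 - exp (- x)) \<le> 1 + 1 / x"
proof -
  have e: "exp (- x) < 1" using assms by simp
  have "1 + x \<le> exp x" by (rule exp_ge_add_one_self)
  hence "(1 + x) * exp (- x) \<le> 1" using mult_right_mono[of "1 + x" "exp x" "exp (- x)"] by (simp add: exp_minus)
  hence "x \<le> (x + 1) * (1 - exp (- x))" by (simp add: algebra_simps)
  thus ?thesis using assms e by (simp add: field_simps)
qed

lemma crank_form_bound:
  assumes p: "prime p"
  obtains M where "M \<ge> 0" "\<And>t. Im t > 0 \<Longrightarrow> norm (crank_form p t) \<le> exp (2 + M / Im t)"
proof -
  define L where "L = (\<Sum>j. 1 / real (Suc j) ^ 2)"
  have L: "L \<ge> 0"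
    unfolding L_def by (intro suminf_nonneg summable_inverse_squares) simp
  \<comment> \<open>Two upper bounds exp (1 + 1 / y) and two lower bounds exp (- L / y) with y = 2
    pi Im t give the exponent 2 + 2 (1 + L) / y.\<close>
  define M where "M = (1 + L) / pi"
  have "norm (crank_form p t) \<le> exp (2 + M / Im t)" if t: "Im t > 0" for t
  proof -
    define y where "y = 2 * pi * Im t"
    have y: "y > 0" using t by (simp add: y_def)
    have q: "norm (ecis t) = exp (- y)" by (simp add: norm_ecis y_def)
    have upper: "norm (qpoch (ecis s) (ecis s)) \<le> exp (1 + 1 / y)" if "Im s \<ge> Im t" for s
    proof -
      define x where "x = 2 * pi * Im s"
      have x: "y \<le> x" "x > 0" using that t by (auto simp: x_def y_def)
      have "norm (qpoch (ecis s) (ecis s)) \<le> exp (1 / (1 - norm (ecis s)))"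
        using x by (intro norm_qpoch_le) (auto simp: norm_ecis x_def)
      also have "norm (ecis s) = exp (- x)" by (simp add: norm_ecis x_def)
      also have "1 / (1 - exp (- x)) \<le> 1 + 1 / y"
        using inverse_one_minus_exp_le[OF x(2)] x y by (smt (verit) frac_le)
      finally show ?thesis by simp
    qed
    have lower: "norm (qpoch (x * ecis t) (ecis t)) \<ge> exp (- L / y)" if "norm x = 1" for x
      unfolding L_def using that by (intro norm_qpoch_ge q y) (simp add: norm_mult)
    have "norm (qpoch (zeta p * ecis t) (ecis t) * qpoch (inverse (zeta p) * ecis t) (ecis t)) \<ge> exp (- L / y) * exp (- L / y)"
      unfolding norm_mult by (intro mult_mono lower) (auto simp: norm_inverse)
    hence gf: "norm (crank_gf (zeta p) (ecis t)) \<le> exp (1 + 1 / y) / (exp (- L / y) * exp (- L / y))"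
      unfolding crank_gf_def norm_divide by (intro frac_le upper) auto
    have "1 * Im t \<le> real p ^ 2 * Im t"
      using prime_gt_0_nat[OF p] t by (intro mult_right_mono) auto
    hence "norm (qpoch (ecis (of_nat p ^ 2 * t)) (ecis (of_nat p ^ 2 * t))) \<le> exp (1 + 1 / y)"
      by (intro upper) (simp flip: of_nat_power)
    moreover have "norm (ecis (of_int (s_p p) * t)) \<le> 1"
      using s_p_nonneg[OF p] t by (simp add: norm_ecis)
    ultimately have "norm (crank_form p t) \<le> 1 * exp (1 + 1 / y) * (exp (1 + 1 / y) / (exp (- L / y) * exp (- L / y)))"
      unfolding crank_form_def norm_mult using gf by (intro mult_mono) auto
    also have "\<dots> = exp (2 + M / Im t)"
    proof -
      have "exp (1 + 1 / y) * (exp (1 + 1 / y) / (exp (- L / y) * exp (- L / y))) =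
         exp ((1 + 1 / y) + ((1 + 1 / y) - (- L / y + - L / y)))"
        by (simp only: exp_add exp_diff)
      also have "(1 + 1 / y) + ((1 + 1 / y) - (- L / y + - L / y)) = 2 + M / Im t"
        using t by (simp add: y_def M_def field_simps)
      finally show ?thesis by simp
    qed
    finally show ?thesis .
  qed
  moreover have "M \<ge> 0" using L by (simp add: M_def)
  ultimately show ?thesis using that by blast
qed

lemma holomorphic_crank_form:
  assumes "prime p" "p > 3"
  shows "crank_form p holomorphic_on upper_half_plane"
proof -
  have "open upper_half_plane" unfolding upper_half_plane_def by (rule open_halfspace_Im_gt)
  moreover have "(\<lambda>t. crank_gf (zeta p) (ecis t)) holomorphic_on upper_half_plane"
  proof -
    have "(crank_gf (zeta p) \<circ> ecis) holomorphic_on upper_half_plane"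
      by (rule holomorphic_on_compose_gen[OF _ holomorphic_crank_gf[OF norm_zeta]])
         (auto intro!: holomorphic_ecis simp: upper_half_plane_def norm_ecis)
    thus ?thesis by (simp add: o_def)
  qed
  moreover have "Im (of_nat p ^ 2 * t) > 0" if "t \<in> upper_half_plane" for t
    using that assms by (simp add: upper_half_plane_def flip: of_nat_power)
  ultimately show ?thesis
    unfolding crank_form_def[abs_def]
    by (intro holomorphic_intros holomorphic_qpoch norm_ecis_less_1) auto
qed

lemma K_crank_bound:
  assumes p: "prime p"
  obtains M where "M \<ge> 0" "\<And>z. Im z > 0 \<Longrightarrow> norm (K_crank p m z) \<le> exp (2 + M / Im z)"
proof -
  obtain M where M: "M \<ge> 0" "\<And>t. Im t > 0 \<Longrightarrow> norm (crank_form p t) \<le> exp (2 + M / Im t)"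
    using crank_form_bound[OF p] by blast
  have p0: "p > 0" using p by (rule prime_gt_0_nat)
  have "norm (K_crank p m z) \<le> exp (2 + (real p * M) / Im z)" if z: "Im z > 0" for z
  proof -
    have Im: "Im ((z + of_nat k) / of_nat p) = Im z / real p" for k
      by (simp add: Im_divide_of_nat)
    have "norm (\<Sum>k<p. ecis (- (of_nat m * of_nat k / of_nat p)) * crank_form p ((z + of_nat k) / of_nat p)) \<le>
       (\<Sum>k<p. exp (2 + (real p * M) / Im z))"
    proof (rule sum_norm_le)
      fix k
      have "Im (- (of_nat m * of_nat k / of_nat p)) = 0" by (simp add: Im_divide_of_nat)
      hence "norm (ecis (- (of_nat m * of_nat k / of_nat p))) = 1" unfolding norm_ecis by simp
      moreover have "norm (crank_form p ((z + of_nat k) / of_nat p)) \<le> exp (2 + (real p * M) / Im z)"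
        using M(2)[of "(z + of_nat k) / of_nat p"] z p0 unfolding Im by (simp add: mult.commute)
      ultimately show "norm (ecis (- (of_nat m * of_nat k / of_nat p)) * crank_form p ((z + of_nat k) / of_nat p)) \<le>
         exp (2 + (real p * M) / Im z)" by (simp add: norm_mult)
    qed
    thus ?thesis unfolding K_crank_eq_average[OF z p0] using p0 by (simp add: norm_divide field_simps)
  qed
  moreover have "real p * M \<ge> 0" using M by simp
  ultimately show ?thesis using that by blast
qed

lemma holomorphic_K_crank:
  assumes p: "prime p" "p > 3"
  shows "K_crank p m holomorphic_on upper_half_plane"
proof -
  have p0: "p > 0" using p by simp
  have "(\<lambda>z. crank_form p ((z + of_nat k) / of_nat p)) holomorphic_on upper_half_plane" for k
  proof -
    have "(crank_form p \<circ> (\<lambda>z. (z + of_nat k) / of_nat p)) holomorphic_on upper_half_plane"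
      by (rule holomorphic_on_compose_gen[OF _ holomorphic_crank_form[OF p]])
         (use p0 in \<open>auto intro!: holomorphic_intros simp: upper_half_plane_def Im_divide_of_nat\<close>)
    thus ?thesis by (simp add: o_def)
  qed
  hence "(\<lambda>z. (\<Sum>k<p. ecis (- (of_nat m * of_nat k / of_nat p)) * crank_form p ((z + of_nat k) / of_nat p)) / of_nat p)
      holomorphic_on upper_half_plane"
    using p0 by (intro holomorphic_intros) auto
  thus ?thesis
    by (rule holomorphic_transform) (simp add: K_crank_eq_average p0 upper_half_plane_def)
qed

section \<open>Transformation of the averages under Gamma_1(p)\<close>

lemma sum_periodic_shift:
  fixes h :: "int \<Rightarrow> complex"
  assumes "\<And>k. h (k + int p) = h k"
  shows "(\<Sum>k<p. h (int k + b)) = (\<Sum>k<p. h (int k))"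
proof -
  have step: "(\<Sum>k<p. h (int k + (c + 1))) = (\<Sum>k<p. h (int k + c))" for c
  proof -
    have "h c + (\<Sum>k<p. h (int k + (c + 1))) = (\<Sum>k<Suc p. h (int k + c))"
      by (subst sum.lessThan_Suc_shift) (simp add: add_ac)
    also have "\<dots> = (\<Sum>k<p. h (int k + c)) + h c" using assms[of c] by (simp add: add.commute)
    finally show ?thesis by simp
  qed
  show ?thesis
  proof (induction b rule: int_induct[where k = 0])
    case (step1 i)
    thus ?case using step[of i] by simp
  next
    case (step2 i)
    thus ?case using step[of "i - 1"] by simp
  qed auto
qed

text \<open>Conjugation by z -> z / p gives the matrix (a, b / p; p c, d), to which
  \<open>crank_form_modular\<close> applies.\<close>

lemma crank_form_GammaN:
  fixes a b c d :: int
  assumes p: "prime p" "p > 3" and det: "a * d - b * c = 1" and w: "Im w > 0"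
    and b: "int p dvd b" and c: "int p dvd c" and d: "d mod int p = 1 mod int p"
  shows "crank_form p ((of_int a * w + of_int b) / (of_int c * w + of_int d) / of_nat p) =
           (of_int c * w + of_int d) * crank_form p (w / of_nat p)"
proof -
  obtain b' c' where b': "b = int p * b'" and c': "c = int p * c'" using b c by blast
  define P where "P = (of_nat p :: complex)"
  have P: "P \<noteq> 0" using p by (simp add: P_def)
  have "a * d - b' * (int p * c) = 1" using det by (simp add: b' mult_ac)
  moreover have "int p ^ 2 dvd int p * c" by (simp add: c' power2_eq_square)
  moreover have "Im (w / of_nat p) > 0" using w p by (simp add: Im_divide_of_nat)
  ultimately have "crank_form p ((of_int a * (w / P) + of_int b') / (of_int (int p * c) * (w / P) + of_int d)) =
      (of_int (int p * c) * (w / P) + of_int d) * crank_form p (w / P)"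
    unfolding P_def by (intro crank_form_modular[OF p] d)
  moreover have "of_int (int p * c) * (w / P) = of_int c * w" using P by (simp add: P_def)
  moreover have "of_int a * (w / P) + of_int b' = (of_int a * w + of_int b) / P"
    using P by (simp add: b' P_def[symmetric] field_simps)
  ultimately show ?thesis by (simp add: P_def mult.commute)
qed

text \<open>The summand \<open>h\<close> has period p in k because \<open>crank_form\<close> is
  invariant under t -> t + 1. The matrix carries the k-th value of the form to the (k + b)-th, so a
  cyclic shift of the sum leaves only the change in the root of unity.\<close>

lemma K_crank_Gamma1:
  fixes a b c d :: int
  assumes p: "prime p" "p > 3" and z: "Im z > 0" and A: "(a, b, c, d) \<in> Gamma1 p"
  shows "K_crank p m ((of_int a * z + of_int b) / (of_int c * z + of_int d)) =
           (of_int c * z + of_int d) * ecis (of_int b * of_nat m / of_nat p) * K_crank p m z"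
proof -
  have p0: "p > 0" using p by simp
  have det: "a * d - b * c = 1" and c: "int p dvd c" and a: "a mod int p = 1 mod int p" and d: "d mod int p = 1 mod int p"
    using A by (auto simp: Gamma1_def SL2Z_def)
  define J where "J = of_int c * z + of_int d"
  have J: "J \<noteq> 0" using moebius_denominator_nonzero[OF det z] by (simp add: J_def)
  define h where "h = (\<lambda>k::int. ecis (- (of_nat m * of_int k / of_nat p)) * crank_form p ((z + of_int k) / of_nat p))"
  have per: "h (k + int p) = h k" for k
  proof -
    have "crank_form p ((of_int 1 * ((z + of_int k) / of_nat p) + of_int 1) / (of_int 0 * ((z + of_int k) / of_nat p) + of_int 1)) =
      (of_int 0 * ((z + of_int k) / of_nat p) + of_int 1) * crank_form p ((z + of_int k) / of_nat p)"
      using z p0 by (intro crank_form_modular[OF p]) (auto simp: Im_divide_of_nat)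
    moreover have "(z + of_int (k + int p)) / of_nat p = (z + of_int k) / of_nat p + 1"
      using p0 by (simp add: field_simps)
    moreover have "ecis (- (of_nat m * of_int (k + int p) / of_nat p)) = ecis (- (of_nat m * of_int k / of_nat p))"
      using p0 by (intro ecis_eqI[of _ _ "- int m"]) (simp add: field_simps)
    ultimately show ?thesis by (simp add: h_def)
  qed
  have form: "crank_form p (((of_int a * z + of_int b) / J + of_nat k) / of_nat p) =
      J * crank_form p ((z + of_int (int k + b)) / of_nat p)" for k
  proof -
    \<comment> \<open>The entries of T^k A T^(-l), where T is translation by 1. With a and d equal
      to 1 and c equal to 0 modulo p, the choice l = k + b makes the upper right entry divisible by
      p.\<close>
    define l a' b' d' where "l = int k + b" and "a' = a + int k * c" and "b' = b + int k * d - l * (a + int k * c)"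
      and "d' = d - l * c"
    have "a' * d' - b' * c = a * d - b * c" by (simp add: a'_def b'_def d'_def algebra_simps)
    hence det': "a' * d' - b' * c = 1" using det by simp
    obtain c0 a0 d0 where c0: "c = int p * c0" and a0: "a = 1 + int p * a0" and d0: "d = 1 + int p * d0"
      using c a d by (metis dvdE mod_eq_dvd_iff add.commute diff_add_cancel)
    have b': "int p dvd b'"
    proof -
      have "b' = int p * (int k * d0 - l * a0 - l * int k * c0)"
        by (simp add: b'_def l_def c0 a0 d0 algebra_simps)
      thus ?thesis by simp
    qed
    have d': "d' mod int p = 1 mod int p"
    proof -
      have "int p dvd d' - 1" by (simp add: d'_def c0 d0 dvd_diff)
      thus ?thesis by (simp add: mod_eq_dvd_iff)
    qed
    have "Im (z + of_int l) > 0" using z by simp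
    from crank_form_GammaN[OF p det' this b' c d']
    have "crank_form p ((of_int a' * (z + of_int l) + of_int b') / (of_int c * (z + of_int l) + of_int d') / of_nat p) =
       (of_int c * (z + of_int l) + of_int d') * crank_form p ((z + of_int l) / of_nat p)" .
    moreover have "of_int c * (z + of_int l) + of_int d' = J" by (simp add: d'_def J_def algebra_simps)
    moreover have "(of_int a' * (z + of_int l) + of_int b') / J = (of_int a * z + of_int b) / J + of_nat k"
    proof -
      have "of_int a' * (z + of_int l) + of_int b' = of_int a * z + of_int b + of_nat k * J"
        by (simp add: a'_def b'_def J_def algebra_simps)
      thus ?thesis using J by (simp add: add_divide_distrib)
    qed
    ultimately show ?thesis unfolding l_def[symmetric] by (simp only:)
  qed
  have "of_nat p * K_crank p m ((of_int a * z + of_int b) / J) =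
      (\<Sum>k<p. ecis (- (of_nat m * of_nat k / of_nat p)) * (J * crank_form p ((z + of_int (int k + b)) / of_nat p)))"
    using K_crank_eq_average[OF Im_moebius_pos[OF det z] p0, of m] p0 by (simp add: J_def[symmetric] form)
  also have "\<dots> = (\<Sum>k<p. J * ecis (of_int b * of_nat m / of_nat p) * h (int k + b))"
  proof (rule sum.cong)
    fix k
    have "ecis (- (of_nat m * of_nat k / of_nat p)) =
        ecis (of_int b * of_nat m / of_nat p) * ecis (- (of_nat m * of_int (int k + b) / of_nat p))"
      unfolding ecis_add[symmetric] using p0 by (intro arg_cong[where f = ecis]) (simp add: field_simps)
    thus "ecis (- (of_nat m * of_nat k / of_nat p)) * (J * crank_form p ((z + of_int (int k + b)) / of_nat p)) =
        J * ecis (of_int b * of_nat m / of_nat p) * h (int k + b)"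
      by (simp add: h_def mult_ac)
  qed auto
  also have "\<dots> = J * ecis (of_int b * of_nat m / of_nat p) * (\<Sum>k<p. h (int k))"
    by (simp only: sum_distrib_left[symmetric] sum_periodic_shift[of h, OF per])
  also have "(\<Sum>k<p. h (int k)) = of_nat p * K_crank p m z"
    using K_crank_eq_average[OF z p0, of m] p0 by (simp add: h_def)
  finally show ?thesis using p0 by (simp add: J_def[symmetric])
qed

lemma slash_K_crank_Gamma1:
  assumes p: "prime p" "p > 3" and z: "Im z > 0" and A: "(a, b, c, d) \<in> Gamma1 p"
  shows "slash 1 (a, b, c, d) (K_crank p m) z = ecis (of_int b * of_nat m / of_nat p) * K_crank p m z"
proof -
  have "a * d - b * c = 1" using A by (auto simp: Gamma1_def SL2Z_def)
  hence "of_int c * z + of_int d \<noteq> 0" using z by (rule moebius_denominator_nonzero)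
  thus ?thesis unfolding slash_def prod.case K_crank_Gamma1[OF p z A]
    by (simp add: power_int_minus mult.assoc[symmetric])
qed

text \<open>The cusps need no separate transformation formulas: periodicity comes from the normality of
  \<open>\<Gamma>(p)\<close>, and the bound by \<open>exp (M / Im z)\<close> near the real line becomes exponential growth
  in \<open>Im z\<close> after applying \<open>A\<close>.\<close>
lemma meromorphic_at_infinity_slash_K_crank:
  assumes p: "prime p" "p > 3" and A: "A \<in> SL2Z"
  shows "meromorphic_at_infinity (slash 1 A (K_crank p m))"
proof -
  obtain a b c d where Aeq: "A = (a, b, c, d)" by (cases A) auto
  have det: "a * d - b * c = 1" using A by (simp add: Aeq SL2Z_def)
  define J where "J = (\<lambda>z::complex. of_int c * z + of_int d)"
  define S where "S = (\<lambda>z::complex. (of_int a * z + of_int b) / J z)"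
  have J: "J z \<noteq> 0" if "Im z > 0" for z using moebius_denominator_nonzero[OF det that] by (simp add: J_def)
  have S: "Im (S z) > 0" if "Im z > 0" for z using Im_moebius_pos[OF det that] by (simp add: S_def J_def)
  have F: "slash 1 A (K_crank p m) = (\<lambda>z. K_crank p m (S z) / J z)"
    by (auto simp: fun_eq_iff slash_def Aeq S_def J_def power_int_minus divide_inverse)
  obtain M where M: "M \<ge> 0" "\<And>z. Im z > 0 \<Longrightarrow> norm (K_crank p m z) \<le> exp (2 + M / Im z)"
    using K_crank_bound[OF p(1)] by blast
  \<comment> \<open>Chosen so that |c z + d| <= L Im z when Im z >= 1 and |Re z| <= p.\<close>
  define L where "L = \<bar>of_int c\<bar> * (real p + 1) + \<bar>of_int d :: real\<bar>"
  show ?thesis unfolding F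
  proof (rule meromorphic_at_infinity_of_growth[where h = p and C = "exp 2" and M = "M * L ^ 2"])
    show "p > 0" using p by simp
    have "(K_crank p m \<circ> S) holomorphic_on upper_half_plane"
      unfolding S_def by (rule holomorphic_on_compose_gen[OF _ holomorphic_K_crank[OF p]])
        (use J S in \<open>auto intro!: holomorphic_intros simp: upper_half_plane_def J_def S_def\<close>)
    thus "(\<lambda>z. K_crank p m (S z) / J z) holomorphic_on upper_half_plane"
      using J by (intro holomorphic_intros) (auto simp: o_def J_def upper_half_plane_def intro!: holomorphic_intros)
    show "K_crank p m (S (z + of_nat p)) / J (z + of_nat p) = K_crank p m (S z) / J z" if z: "Im z > 0" for z
    proof -
      define P where "P = int p"
      \<comment> \<open>This is A T^p A^(-1) with T translation by 1. Its upper right entry a^2 p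
        makes the multiplier trivial, so A has period p after slashing.\<close>
      have B: "(1 - a * c * P, a ^ 2 * P, - (c ^ 2) * P, 1 + a * c * P) \<in> Gamma1 p"
        by (auto simp: Gamma1_def SL2Z_def P_def mod_eq_dvd_iff algebra_simps power2_eq_square)
      have J1: "J z \<noteq> 0" "J (z + of_nat p) \<noteq> 0" using z by (auto intro!: J)
      have det': "of_int a * of_int d - of_int b * of_int c = (1 :: complex)"
        using det by (simp flip: of_int_mult of_int_diff)
      have aS: "of_int a - of_int c * S z = 1 / J z"
      proof -
        have "of_int a * J z - of_int c * (of_int a * z + of_int b) = 1"
          using det' by (simp add: J_def algebra_simps)
        thus ?thesis using J1 by (simp add: S_def field_simps)
      qed
      have j: "of_int (- (c ^ 2) * P) * S z + of_int (1 + a * c * P) = J (z + of_nat p) / J z"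
      proof -
        have "of_int (- (c ^ 2) * P) * S z + of_int (1 + a * c * P) = 1 + of_int c * of_nat p * (of_int a - of_int c * S z)"
          by (simp add: P_def algebra_simps power2_eq_square)
        also have "\<dots> = J (z + of_nat p) / J z" unfolding aS using J1(1) by (simp add: J_def field_simps)
        finally show ?thesis .
      qed
      have n: "of_int (1 - a * c * P) * S z + of_int (a ^ 2 * P) = S z + of_int a * of_nat p / J z"
      proof -
        have "of_int (1 - a * c * P) * S z + of_int (a ^ 2 * P) = S z + of_int a * of_nat p * (of_int a - of_int c * S z)"
          by (simp add: P_def algebra_simps power2_eq_square)
        thus ?thesis unfolding aS by simp
      qed
      have "S (z + of_nat p) = (of_int (1 - a * c * P) * S z + of_int (a ^ 2 * P)) / (of_int (- (c ^ 2) * P) * S z + of_int (1 + a * c * P))"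
        unfolding n j using J1 by (simp add: S_def field_simps)
      hence "K_crank p m (S (z + of_nat p)) = J (z + of_nat p) / J z * ecis (of_int (a ^ 2 * P) * of_nat m / of_nat p) * K_crank p m (S z)"
        using K_crank_Gamma1[OF p S[OF z] B, of m] by (simp only: j)
      also have "of_int (a ^ 2 * P) * of_nat m / of_nat p = (of_int (a ^ 2 * int m) :: complex)"
        using p by (simp add: P_def)
      finally show ?thesis unfolding ecis_of_int using J1 by simp
    qed
    show "norm (K_crank p m (S z) / J z) \<le> exp 2 * exp (M * L ^ 2 * Im z)" if z: "Im z \<ge> 1" "\<bar>Re z\<bar> \<le> real p" for z
    proof -
      have Imz: "Im z > 0" using z by simp
      \<comment> \<open>Ensures that dividing by \<open>J z\<close> does not enlarge the
        bound.\<close>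
      have J1: "norm (J z) \<ge> 1"
      proof (cases "c = 0")
        case True
        hence "\<bar>d\<bar> = 1" using det by (metis abs_zmult_eq_1 diff_zero mult_zero_right mult.commute abs_1)
        thus ?thesis using True by (simp add: J_def)
      next
        case False
        hence "1 * 1 \<le> \<bar>of_int c\<bar> * \<bar>Im z\<bar>" using z by (intro mult_mono) auto
        also have "\<dots> = \<bar>Im (J z)\<bar>" by (simp add: J_def abs_mult)
        also have "\<dots> \<le> norm (J z)" by (rule abs_Im_le_cmod)
        finally show ?thesis by simp
      qed
      have JL: "norm (J z) \<le> L * Im z"
      proof -
        have "norm (J z) \<le> \<bar>of_int c\<bar> * norm z + \<bar>of_int d\<bar>"
          unfolding J_def by (rule order_trans[OF norm_triangle_ineq]) (simp add: norm_mult)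
        also have "norm z \<le> (real p + 1) * Im z"
        proof -
          have "norm z \<le> \<bar>Re z\<bar> + \<bar>Im z\<bar>" by (rule cmod_le)
          also have "\<dots> \<le> real p * Im z + Im z"
            using z mult_left_mono[of 1 "Im z" "real p"] by simp
          finally show ?thesis by (simp add: algebra_simps)
        qed
        also have "\<bar>of_int c\<bar> * ((real p + 1) * Im z) + \<bar>of_int d\<bar> \<le> L * Im z"
          using z mult_left_mono[of 1 "Im z" "\<bar>of_int d :: real\<bar>"] by (simp add: L_def algebra_simps)
        finally show ?thesis by (simp add: mult_left_mono)
      qed
      \<comment> \<open>Since Im (S z) = Im z / |J z|^2, the bound near the real line becomes
        exponential growth linear in Im z.\<close>
      have "M / Im (S z) = M * (norm (J z) ^ 2 / Im z)"
        using Im_moebius[OF det Imz] by (simp add: S_def J_def)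
      also have "\<dots> \<le> M * ((L * Im z) ^ 2 / Im z)"
        using JL Imz M(1) by (intro mult_left_mono divide_right_mono power_mono) auto
      also have "\<dots> = M * L ^ 2 * Im z" using Imz by (simp add: power2_eq_square)
      finally have "norm (K_crank p m (S z)) \<le> exp (2 + M * L ^ 2 * Im z)"
        using M(2)[OF S[OF Imz]] by (smt (verit) exp_le_cancel_iff)
      moreover have "norm (K_crank p m (S z)) / norm (J z) \<le> norm (K_crank p m (S z))"
        using J1 by (simp add: divide_le_eq mult_le_cancel_left1)
      ultimately show ?thesis by (simp add: norm_divide exp_add)
    qed
  qed
qed

text \<open>Serves both groups: the multiplier exp (2 pi i b m / p) is 1 if m = 0, and also if p
  divides b.\<close>

lemma weakly_holomorphic_modular_form_K_crank:
  assumes p: "prime p" "p > 3"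
    and G: "\<And>a b c d. (a, b, c, d) \<in> G \<Longrightarrow> (a, b, c, d) \<in> Gamma1 p \<and> (m = 0 \<or> int p dvd b)"
  shows "weakly_holomorphic_modular_form 1 G (K_crank p m)"
  unfolding weakly_holomorphic_modular_form_def
proof (intro conjI ballI)
  show "K_crank p m holomorphic_on upper_half_plane" by (rule holomorphic_K_crank[OF p])
  show "meromorphic_at_infinity (slash 1 A (K_crank p m))" if "A \<in> SL2Z" for A
    using that by (rule meromorphic_at_infinity_slash_K_crank[OF p])
  fix A z assume A: "A \<in> G" and z: "z \<in> upper_half_plane"
  obtain a b c d where Aeq: "A = (a, b, c, d)" by (cases A) auto
  have *: "(a, b, c, d) \<in> Gamma1 p" "m = 0 \<or> int p dvd b" using G A by (auto simp: Aeq)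
  have "ecis (of_int b * of_nat m / of_nat p) = 1"
  proof (cases "m = 0")
    case False
    then obtain k where "b = int p * k" using * by auto
    hence "of_int b * of_nat m / of_nat p = (of_int (k * int m) :: complex)" using p by simp
    thus ?thesis by (simp only: ecis_of_int)
  qed auto
  thus "slash 1 A (K_crank p m) z = K_crank p m z"
    using slash_K_crank_Gamma1[OF p _ *(1), of z m] z by (simp add: Aeq upper_half_plane_def)
qed

theorem theorem2p6:
  fixes p m :: nat
  assumes "prime p" and "p > 3" and "m \<le> p - 1"
  shows "(m = 0 \<longrightarrow> weakly_holomorphic_modular_form 1 (Gamma1 p) (K_crank p 0)) \<and>
         (1 \<le> m \<longrightarrow>
            weakly_holomorphic_modular_form 1 (GammaN p) (K_crank p m) \<and>
            (\<forall>a b c d. (a,b,c,d) \<in> Gamma1 p \<longrightarrow> (\<forall>z\<in>upper_half_plane.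
               slash 1 (a,b,c,d) (K_crank p m) z =
                 exp (2 * pi * \<i> * of_int b * of_nat m / of_nat p) * K_crank p m z)))"
proof -
  have p: "prime p" "p > 3" using assms by auto
  show ?thesis
  proof (intro conjI impI allI ballI)
    assume "m = 0"
    show "weakly_holomorphic_modular_form 1 (Gamma1 p) (K_crank p 0)"
      by (rule weakly_holomorphic_modular_form_K_crank[OF p]) auto
  next
    show "weakly_holomorphic_modular_form 1 (GammaN p) (K_crank p m)"
      by (rule weakly_holomorphic_modular_form_K_crank[OF p]) (auto simp: GammaN_def Gamma1_def mod_0_imp_dvd)
  next
    fix a b c d z
    assume A: "(a, b, c, d) \<in> Gamma1 p" and "z \<in> upper_half_plane"
    hence "Im z > 0" by (simp add: upper_half_plane_def)
    from slash_K_crank_Gamma1[OF p this A, of m]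
    show "slash 1 (a, b, c, d) (K_crank p m) z =
        exp (2 * pi * \<i> * of_int b * of_nat m / of_nat p) * K_crank p m z"
      by (simp only: ecis_def times_divide_eq_right mult.assoc)
  qed
qed

end
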